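(* If $(S,\mu)$ is a series-parallel labelled poset and $x \in S$, then $$E(S\setminus x, \mu) \preceq E(S,\mu).$$
   Context: All posets are finite. A labelled poset $(P,\omega)$ is a finite poset $P$ together with an injective function $\omega : P \to \mathbb{N}$ (a labelling). A $(P,\omega)$-partition with largest part $\le n$ is a map $\sigma : P \to [n]=\{1,\dots,n\}$ such that (1) if $x \le y$ in $P$ then $\sigma(x) \ge \sigma(y)$; (2) if $x<y$ in $P$ and $\omega(x)>\omega(y)$ then $\sigma(x)>\sigma(y)$. Let $e_k(P,\omega)$ be the number of surjective $(P,\omega)$-partitions $\sigma: P \to [k]$. The $E$-polynomial of $(P,\omega)$ is $$E(P,\omega) = \sum_{k=1}^{|P|} e_k(P,\omega)\,x^k \in \mathbb{R}[x]$$ for $P$ nonempty, and $E(\emptyset)=1$. For $y \in P$, $P \setminus y$ is the poset on $P\setminus\{y\}$ with the inherited order, and $(P\setminus y,\omega)$ denotes this poset labelled by the restriction of $\omega$. Let $(P,\omega)$, $(Q,\nu)$ be labelled posets. - The ordinal sum $P \oplus Q$ is the disjoint union of $P$ and $Q$ as a set, with $x \le y$ iff $x \le_P y$, or $x \le_Q y$, or $x \in P, y \in Q$. $\omega \oplus_0 \nu$ denotes any labelling of $P\oplus Q$ with $(\omega\oplus_0\nu)(x)<(\omega\oplus_0\nu)(y)$ whenever ($x,y\in P$ and $\omega(x)<\omega(y)$), or ($x,y\in Q$ and $\nu(x)<\nu(y)$), or ($x\in P$, $y\in Q$). $\omega \oplus_1 \nu$ denotes any labelling of $P \oplus Q$ with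 the analogous property in which the last alternative is replaced by ($x\in Q$, $y\in P$). - The disjoint union $P \sqcup Q$ is the disjoint union as a set with $x<y$ iff $x<_P y$ or $x<_Q y$. $\omega\sqcup\nu$ denotes any labelling of $P \sqcup Q$ such that $(\omega\sqcup\nu)(x)<(\omega\sqcup\nu)(y)$ whenever ($x,y\in P$ and $\omega(x)<\omega(y)$) or ($x,y\in Q$ and $\nu(x)<\nu(y)$). Series-parallel labelled posets are defined recursively: $(S,\mu)$ is series-parallel if it is empty, has one element, or equals $(P \oplus Q, \omega \oplus_0 \nu)$, $(P \oplus Q, \omega \oplus_1 \nu)$ or $(P \sqcup Q, \omega \sqcup \nu)$ for some series-parallel $(P,\omega)$ and $(Q,\nu)$. Interlacing: a nonzero polynomial is real-rooted if all its complex zeros are real (nonzero constants included). For nonzero real-rooted $f,g\in\mathbb{R}[x]$ with $\deg(f)=\deg(g)+1=d$, with zeros $\alpha_1 \leq \cdots \leq \alpha_d$ of $f$ and $\beta_1 \leq \cdots \leq \beta_{d-1}$ of $g$ (with multiplicity), $g \preceq f$ means $\alpha_1 \leq \beta_1 \leq \alpha_2 \leq \cdots \leq \beta_{d-1} \leq \alpha_d$. The relation $g \preceq f$ includes the requirement that both are real-rooted and $\deg(f)=\deg(g)+1$. *)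

theory Defs
  imports
    "HOL-Library.FuncSet"
    "HOL-Library.Multiset"
    "HOL-Computational_Algebra.Computational_Algebra"
begin

text \<open>A labelled poset is a triple of a finite carrier, an order relation on it (a set of pairs,
  \<open>(x, y) \<in> r\<close> meaning \<open>x \<le> y\<close>) and a labelling. Labellings are total functions of which only the
  values on the carrier matter.\<close>

definition labelled_poset :: "'a set \<Rightarrow> 'a rel \<Rightarrow> ('a \<Rightarrow> nat) \<Rightarrow> bool" where
  "labelled_poset P r \<omega> \<longleftrightarrow> finite P \<and> partial_order_on P r \<and> inj_on \<omega> P"

definition P_partitions :: "'a set \<Rightarrow> 'a rel \<Rightarrow> ('a \<Rightarrow> nat) \<Rightarrow> nat \<Rightarrow> ('a \<Rightarrow> nat) set" where
  "P_partitions P r \<omega> n =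
     {\<sigma> \<in> P \<rightarrow>\<^sub>E {1..n}.
        (\<forall>x y. (x, y) \<in> r \<longrightarrow> \<sigma> x \<ge> \<sigma> y) \<and>
        (\<forall>x y. (x, y) \<in> r \<and> x \<noteq> y \<and> \<omega> x > \<omega> y \<longrightarrow> \<sigma> x > \<sigma> y)}"

definition surj_count :: "'a set \<Rightarrow> 'a rel \<Rightarrow> ('a \<Rightarrow> nat) \<Rightarrow> nat \<Rightarrow> nat" where
  "surj_count P r \<omega> k = card {\<sigma> \<in> P_partitions P r \<omega> k. \<sigma> ` P = {1..k}}"

definition E_poly :: "'a set \<Rightarrow> 'a rel \<Rightarrow> ('a \<Rightarrow> nat) \<Rightarrow> real poly" where
  "E_poly P r \<omega> =
     (if P = {} then 1 else (\<Sum>k = 1..card P. monom (real (surj_count P r \<omega> k)) k))"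

definition ordinal_sum :: "'a set \<Rightarrow> 'a rel \<Rightarrow> 'a set \<Rightarrow> 'a rel \<Rightarrow> 'a rel" where
  "ordinal_sum P r Q s = r \<union> s \<union> P \<times> Q"

text \<open>The three kinds of labellings \<open>\<mu>\<close> of \<open>P \<union> Q\<close> induced by \<open>\<omega>\<close> on \<open>P\<close> and \<open>\<nu>\<close> on \<open>Q\<close>;
  each is only determined up to the order of the labels.\<close>

definition union_labelling ::
    "'a set \<Rightarrow> ('a \<Rightarrow> nat) \<Rightarrow> 'a set \<Rightarrow> ('a \<Rightarrow> nat) \<Rightarrow> ('a \<Rightarrow> nat) \<Rightarrow> bool" where
  "union_labelling P \<omega> Q \<nu> \<mu> \<longleftrightarrow>
     inj_on \<mu> (P \<union> Q) \<and>
     (\<forall>x\<in>P. \<forall>y\<in>P. \<omega> x < \<omega> y \<longrightarrow> \<mu> x < \<mu> y) \<and>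
     (\<forall>x\<in>Q. \<forall>y\<in>Q. \<nu> x < \<nu> y \<longrightarrow> \<mu> x < \<mu> y)"

definition osum0_labelling ::
    "'a set \<Rightarrow> ('a \<Rightarrow> nat) \<Rightarrow> 'a set \<Rightarrow> ('a \<Rightarrow> nat) \<Rightarrow> ('a \<Rightarrow> nat) \<Rightarrow> bool" where
  "osum0_labelling P \<omega> Q \<nu> \<mu> \<longleftrightarrow>
     union_labelling P \<omega> Q \<nu> \<mu> \<and> (\<forall>x\<in>P. \<forall>y\<in>Q. \<mu> x < \<mu> y)"

definition osum1_labelling ::
    "'a set \<Rightarrow> ('a \<Rightarrow> nat) \<Rightarrow> 'a set \<Rightarrow> ('a \<Rightarrow> nat) \<Rightarrow> ('a \<Rightarrow> nat) \<Rightarrow> bool" where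
  "osum1_labelling P \<omega> Q \<nu> \<mu> \<longleftrightarrow>
     union_labelling P \<omega> Q \<nu> \<mu> \<and> (\<forall>x\<in>Q. \<forall>y\<in>P. \<mu> x < \<mu> y)"

text \<open>Disjoint unions are internal: \<open>P\<close> and \<open>Q\<close> are disjoint subsets of one type. Since the type is
  arbitrary, this loses no generality up to isomorphism of labelled posets.\<close>

inductive series_parallel :: "'a set \<Rightarrow> 'a rel \<Rightarrow> ('a \<Rightarrow> nat) \<Rightarrow> bool" where
  empty: "series_parallel {} {} \<mu>"
| single: "series_parallel {a} {(a, a)} \<mu>"
| osum0:
    "\<lbrakk>series_parallel P r \<omega>; series_parallel Q s \<nu>; P \<inter> Q = {}; osum0_labelling P \<omega> Q \<nu> \<mu>\<rbrakk>
      \<Longrightarrow> series_parallel (P \<union> Q) (ordinal_sum P r Q s) \<mu>"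
| osum1:
    "\<lbrakk>series_parallel P r \<omega>; series_parallel Q s \<nu>; P \<inter> Q = {}; osum1_labelling P \<omega> Q \<nu> \<mu>\<rbrakk>
      \<Longrightarrow> series_parallel (P \<union> Q) (ordinal_sum P r Q s) \<mu>"
| disjoint_union:
    "\<lbrakk>series_parallel P r \<omega>; series_parallel Q s \<nu>; P \<inter> Q = {}; union_labelling P \<omega> Q \<nu> \<mu>\<rbrakk>
      \<Longrightarrow> series_parallel (P \<union> Q) (r \<union> s) \<mu>"

lemma partial_order_on_ordinal_sum:
  assumes "partial_order_on P r" "partial_order_on Q s" "P \<inter> Q = {}"
  shows "partial_order_on (P \<union> Q) (ordinal_sum P r Q s)"
proof -
  have sub: "r \<subseteq> P \<times> P" "s \<subseteq> Q \<times> Q" and "refl_on P r" "refl_on Q s"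
    and tr: "trans r" "trans s" and an: "antisym r" "antisym s"
    using assms by (auto simp: order_on_defs)
  then have "refl_on (P \<union> Q) (ordinal_sum P r Q s)"
    by (auto simp: refl_on_def ordinal_sum_def)
  moreover have "trans (ordinal_sum P r Q s)"
    unfolding ordinal_sum_def using sub tr assms(3) by (intro transI) (blast dest: transD)
  moreover have "antisym (ordinal_sum P r Q s)"
    unfolding ordinal_sum_def using sub an assms(3) by (intro antisymI) (blast dest: antisymD)
  ultimately show ?thesis
    using sub by (auto simp: order_on_defs ordinal_sum_def)
qed

lemma partial_order_on_disjoint_union:
  assumes "partial_order_on P r" "partial_order_on Q s" "P \<inter> Q = {}"
  shows "partial_order_on (P \<union> Q) (r \<union> s)"
proof -
  have sub: "r \<subseteq> P \<times> P" "s \<subseteq> Q \<times> Q" and "refl_on P r" "refl_on Q s"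
    and tr: "trans r" "trans s" and an: "antisym r" "antisym s"
    using assms by (auto simp: order_on_defs)
  then have "refl_on (P \<union> Q) (r \<union> s)"
    by (auto simp: refl_on_def)
  moreover have "trans (r \<union> s)"
    using sub tr assms(3) by (intro transI) (blast dest: transD)
  moreover have "antisym (r \<union> s)"
    using sub an assms(3) by (intro antisymI) (blast dest: antisymD)
  ultimately show ?thesis
    using sub by (auto simp: order_on_defs)
qed

lemma series_parallel_labelled_poset:
  "series_parallel S r \<mu> \<Longrightarrow> labelled_poset S r \<mu>"
proof (induction rule: series_parallel.induct)
  case (empty \<mu>)
  then show ?case by (simp add: labelled_poset_def order_on_defs refl_on_def)
next
  case (single a \<mu>)
  then show ?case by (auto simp: labelled_poset_def order_on_defs refl_on_def intro: transI antisymI)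
qed (auto simp: labelled_poset_def osum0_labelling_def osum1_labelling_def union_labelling_def
       intro: partial_order_on_ordinal_sum partial_order_on_disjoint_union)

definition real_rooted :: "real poly \<Rightarrow> bool" where
  "real_rooted p \<longleftrightarrow>
     p \<noteq> 0 \<and> (\<forall>z::complex. poly (map_poly complex_of_real p) z = 0 \<longrightarrow> z \<in> \<real>)"

text \<open>\<open>interlaces g f\<close> is \<open>g \<preceq> f\<close>. Zeros are listed increasingly with multiplicity (0-based);
  by real-rootedness the lists have lengths \<open>degree f\<close> and \<open>degree g\<close>.\<close>

definition interlaces :: "real poly \<Rightarrow> real poly \<Rightarrow> bool" where
  "interlaces g f \<longleftrightarrow>
     real_rooted f \<and> real_rooted g \<and> degree f = degree g + 1 \<and>
     (let \<alpha> = sorted_list_of_multiset (proots f); \<beta> = sorted_list_of_multiset (proots g)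
      in \<forall>i < degree g. \<alpha> ! i \<le> \<beta> ! i \<and> \<beta> ! i \<le> \<alpha> ! (i + 1))"

end

theory Submission
  imports Defs
begin

text \<open>
  Ordinal sums turn into products of \<open>E\<close>-polynomials (up to the factor \<open>(x + 1) / x\<close>), and disjoint
  unions into the bilinear product \<open>\<diamond>\<close> which becomes the pointwise product when \<open>x\<^sup>k\<close> is replaced
  by \<open>N choose k\<close>. By Hermite-Biehler, \<open>g \<preceq> f\<close> follows if \<open>f + \<i> g\<close> has no zero in the open upper half
  plane \<open>U\<close>, so it suffices to carry the two properties "\<open>E(S)\<close> has all zeros in \<open>[-1, 0]\<close>" and
  "\<open>E(S) + \<i> E(S - x)\<close> has no zero in \<open>U\<close>" through the recursion. For products this is
  immediate. If \<open>h\<close> has degree \<open>d\<close> and its zeros \<open>\<beta>\<close> in \<open>[-1, 0]\<close>, then \<open>(h \<diamond> q)(z)\<close> is the coefficient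
  of \<open>y\<^sup>d\<close> in \<open>y\<^sup>d h(z + z (z + 1) / y) q(z + y)\<close>; for \<open>z\<close> in \<open>U\<close> all zeros
  \<open>y = - z (z + 1) / (z - \<beta>)\<close> and \<open>y = \<alpha> - z\<close> of this polynomial lie in the open lower half plane if
  \<open>q\<close> has no zero in \<open>U\<close>, hence so do the zeros of its derivatives (Gauss-Lucas), and
  the coefficient is not zero.
\<close>

section \<open>Polynomials with zeros in a half plane\<close>

text \<open>By the fundamental theorem of algebra a complex polynomial is a constant times monic
  linear factors.\<close>

lemma complex_poly_factor_induct [case_names const factor]:
  fixes p :: "complex poly"
  assumes "\<And>c. P [:c:]" and "\<And>a p. P p \<Longrightarrow> P ([:-a, 1:] * p)"
  shows "P p"
proof (induction "degree p" arbitrary: p)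
  case 0
  then show ?case using assms(1) by (metis degree_eq_zeroE)
next
  case (Suc n)
  then have "\<not> constant (poly p)"
    by (metis constant_degree nat.distinct(1))
  then obtain a where "poly p a = 0"
    using fundamental_theorem_of_algebra by blast
  then obtain q where q: "p = [:-a, 1:] * q"
    by (metis dvdE poly_eq_0_iff_dvd)
  with Suc.hyps(2) have "q \<noteq> 0" by auto
  then have "degree p = Suc (degree q)"
    unfolding q by (subst degree_mult_eq) auto
  with Suc.hyps have "P q" by simp
  then show ?case unfolding q by (rule assms(2))
qed

text \<open>The quotient \<open>p' / p\<close> is the sum of \<open>1 / (z - a)\<close> over the
  zeros \<open>a\<close>. Each \<open>w * (z - a)\<close> has negative real part, and taking
  inverses keeps the sign of the real part. The parameter \<open>w\<close> rotates the half
  plane.\<close>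

lemma Re_logderiv_neg:
  fixes p :: "complex poly"
  assumes roots: "\<And>\<zeta>. poly p \<zeta> = 0 \<Longrightarrow> Re (w * \<zeta>) > 0"
    and z: "Re (w * z) \<le> 0" and deg: "degree p > 0"
  shows "Re (poly (pderiv p) z / (w * poly p z)) < 0"
proof -
  \<comment> \<open>The weak inequality covers constants, where the quotient is 0; one linear factor
    makes it strict.\<close>
  have "(\<forall>\<zeta>. poly p \<zeta> = 0 \<longrightarrow> Re (w * \<zeta>) > 0) \<longrightarrow>
    Re (poly (pderiv p) z / (w * poly p z)) \<le> 0 \<and>
    (degree p > 0 \<longrightarrow> Re (poly (pderiv p) z / (w * poly p z)) < 0)"
  proof (induction p rule: complex_poly_factor_induct)
    case (const c)
    then show ?case by simp
  next
    case (factor a p)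
    show ?case
    proof
      assume r: "\<forall>\<zeta>. poly ([:-a, 1:] * p) \<zeta> = 0 \<longrightarrow> Re (w * \<zeta>) > 0"
      then have r': "\<forall>\<zeta>. poly p \<zeta> = 0 \<longrightarrow> Re (w * \<zeta>) > 0" by simp
      have a: "Re (w * a) > 0" using r by simp
      have pz: "poly p z \<noteq> 0" using r' z by force
      have w: "w \<noteq> 0" using a by auto
      have za: "z \<noteq> a" using a z by auto
      let ?u = "w * (z - a)"
      have "Re ?u < 0" using a z by (simp add: right_diff_distrib)
      then have u: "Re (1 / ?u) < 0"
        by (metis Re_divide_of_real complex_Re_of_int divide_eq_0_iff inverse_eq_divide
              not_less_iff_gr_or_eq order.asym complex_of_real_def inverse_complex.simps(1)
              divide_less_0_iff sum_power2_gt_zero_iff complex_neq_0 zero_complex.sel(1))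
      have "poly (pderiv ([:-a, 1:] * p)) z / (w * poly ([:-a, 1:] * p) z)
          = 1 / ?u + poly (pderiv p) z / (w * poly p z)"
      proof -
        have "poly (pderiv ([:-a, 1:] * p)) z = poly p z + (z - a) * poly (pderiv p) z"
          by (subst pderiv_mult) (simp add: pderiv_pCons algebra_simps)
        moreover have "poly ([:-a, 1:] * p) z = (z - a) * poly p z" by (simp add: algebra_simps)
        moreover have "(P + u * D) / (w * (u * P)) = 1 / (w * u) + D / (w * P)"
          if "P \<noteq> 0" "u \<noteq> 0" for P u D :: complex
          using that w by (simp add: field_simps)
        ultimately show ?thesis using pz za by simp
      qed
      with u factor.IH r'
      have "Re (poly (pderiv ([:-a, 1:] * p)) z / (w * poly ([:-a, 1:] * p) z)) < 0"
        by fastforce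
      then show "Re (poly (pderiv ([:-a, 1:] * p)) z / (w * poly ([:-a, 1:] * p) z)) \<le> 0 \<and>
        (degree ([:-a, 1:] * p) > 0 \<longrightarrow>
          Re (poly (pderiv ([:-a, 1:] * p)) z / (w * poly ([:-a, 1:] * p) z)) < 0)"
        by simp
    qed
  qed
  with roots deg show ?thesis by blast
qed

text \<open>At a critical point outside the half plane the quotient in
  \<open>Re_logderiv_neg\<close> would be 0 and not negative.\<close>

lemma gauss_lucas_halfplane:
  fixes p :: "complex poly"
  assumes roots: "\<And>\<zeta>. poly p \<zeta> = 0 \<Longrightarrow> Re (w * \<zeta>) > 0" and "degree p > 0"
    and "poly (pderiv p) z = 0"
  shows "Re (w * z) > 0"
  using Re_logderiv_neg[OF roots _ assms(2), where z = z] assms(3) by (cases "Re (w * z) \<le> 0") auto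

text \<open>Up to a factorial the coefficient is the value at 0 of the \<open>k\<close>-th
  derivative. The zeros of the derivatives stay in the half plane, and 0 lies outside it.\<close>

lemma coeff_nonzero_halfplane:
  fixes p :: "complex poly"
  assumes "\<And>\<zeta>. poly p \<zeta> = 0 \<Longrightarrow> Re (w * \<zeta>) > 0" and "k \<le> degree p"
  shows "coeff p k \<noteq> 0"
  using assms
proof (induction k arbitrary: p)
  case 0
  then show ?case by (metis less_irrefl mult_zero_right poly_0_coeff_0 zero_complex.sel(1))
next
  case (Suc k)
  have "coeff (pderiv p) k \<noteq> 0"
  proof (rule Suc.IH)
    show "k \<le> degree (pderiv p)" using Suc.prems by (simp add: degree_pderiv)
    show "Re (w * \<zeta>) > 0" if "poly (pderiv p) \<zeta> = 0" for \<zeta>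
      using gauss_lucas_halfplane[of p w \<zeta>] Suc.prems that by auto
  qed
  then show ?case by (auto simp: coeff_pderiv)
qed

section \<open>The diamond product\<close>

text \<open>\<open>diamond_pow i q\<close> is \<open>x\<^sup>i \<diamond> q\<close>.\<close>

definition diamond_pow :: "nat \<Rightarrow> 'a::field_char_0 poly \<Rightarrow> 'a poly" where
  "diamond_pow i q = smult (1 / fact i) (monom 1 i * (pderiv ^^ i) ([:1, 1:] ^ i * q))"

definition diamond :: "'a::field_char_0 poly \<Rightarrow> 'a poly \<Rightarrow> 'a poly" where
  "diamond h q = (\<Sum>i\<le>degree h. smult (coeff h i) (diamond_pow i q))"

lemma diamond_pow_add: "diamond_pow i (p + q) = diamond_pow i p + diamond_pow i q"
  by (simp add: diamond_pow_def distrib_left higher_pderiv_add smult_add_right)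

lemma diamond_pow_smult: "diamond_pow i (smult c q) = smult c (diamond_pow i q)"
  by (simp add: diamond_pow_def higher_pderiv_smult mult.commute)

lemma diamond_add_right: "diamond h (p + q) = diamond h p + diamond h q"
  by (simp add: diamond_def diamond_pow_add smult_add_right sum.distrib)

lemma diamond_smult_right: "diamond h (smult c q) = smult c (diamond h q)"
  by (rule poly_eqI) (simp add: diamond_def diamond_pow_smult coeff_sum sum_distrib_left mult_ac)

text \<open>Taylor expansion of \<open>p\<close> at \<open>z\<close>.\<close>

lemma coeff_pcompose_shift:
  fixes p :: "'a::field_char_0 poly"
  shows "coeff (pcompose p [:z, 1:]) i = poly ((pderiv ^^ i) p) z / fact i"
proof -
  have "(pderiv ^^ i) (pcompose p [:z, 1:]) = pcompose ((pderiv ^^ i) p) [:z, 1:]"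
    by (induction i) (simp_all add: pderiv_pcompose pderiv_pCons)
  then have "coeff ((pderiv ^^ i) (pcompose p [:z, 1:])) 0 = poly ((pderiv ^^ i) p) z"
    by simp
  then show ?thesis
    by (simp add: coeff_higher_pderiv pochhammer_fact[symmetric] field_simps)
qed

lemma pcompose_power:
  fixes p :: "'a::comm_semiring_1 poly"
  shows "pcompose (p ^ n) r = pcompose p r ^ n"
  by (induction n) (simp_all add: pcompose_1 pcompose_mult)

text \<open>The coefficient of \<open>y\<^sup>d\<close> in \<open>y\<^sup>d h (z (y + z + 1) / y) q (z + y)\<close>, where \<open>d = degree h\<close>;
  \<open>A\<close> below is the first factor, as a polynomial in \<open>y\<close>.\<close>

lemma poly_diamond:
  defines "A \<equiv> \<lambda>h z. \<Sum>i\<le>degree h. smult (coeff h i * z ^ i) (monom 1 (degree h - i) * [:z + 1, 1:] ^ i)"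
  shows "poly (diamond h q) z = coeff (A h z * pcompose q [:z, 1:]) (degree h)"
proof -
  have "poly (diamond_pow i q) z = z ^ i * coeff ([:z + 1, 1:] ^ i * pcompose q [:z, 1:]) i" for i
  proof -
    have "pcompose ([:1, 1:] ^ i * q) [:z, 1:] = [:z + 1, 1:] ^ i * pcompose q [:z, 1:]"
      by (simp add: pcompose_mult pcompose_power pcompose_pCons add.commute)
    then show ?thesis
      using coeff_pcompose_shift[of "[:1, 1:] ^ i * q" z i]
      by (simp add: diamond_pow_def poly_monom)
  qed
  \<comment> \<open>The monomial shifts the index, so that all summands can be read off at the same
    power of \<open>y\<close>.\<close>
  moreover have "coeff (monom 1 (degree h - i) * ([:z + 1, 1:] ^ i * pcompose q [:z, 1:])) (degree h)
      = coeff ([:z + 1, 1:] ^ i * pcompose q [:z, 1:]) i" if "i \<le> degree h" for i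
    using that by (simp add: coeff_monom_mult)
  ultimately show ?thesis
    by (simp add: diamond_def A_def poly_sum sum_distrib_right coeff_sum mult.assoc)
qed

definition unit_rooted :: "complex poly \<Rightarrow> bool" where
  "unit_rooted p \<longleftrightarrow> p \<noteq> 0 \<and> (\<forall>z. poly p z = 0 \<longrightarrow> Im z = 0 \<and> - 1 \<le> Re z \<and> Re z \<le> 0)"

text \<open>The wanted value is a coefficient of the polynomial \<open>A * B\<close> in
  \<open>y\<close> built in the proof. Leaving the direction \<open>w\<close> free lets one argument
  serve for \<open>z\<close> in either open half plane and for real \<open>z\<close> outside
  [-1, 0].\<close>

lemma poly_diamond_nonzero:
  fixes h q :: "complex poly" and z w :: complex
  assumes h: "h \<noteq> 0" and q: "q \<noteq> 0" and z: "poly h z \<noteq> 0" "z \<noteq> 0" "z \<noteq> -1"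
    and hr: "\<And>\<beta>. poly h \<beta> = 0 \<Longrightarrow> Re (w * (- (z * (z + 1)) / (z - \<beta>))) > 0"
    and qr: "\<And>\<alpha>. poly q \<alpha> = 0 \<Longrightarrow> Re (w * (\<alpha> - z)) > 0"
  shows "poly (diamond h q) z \<noteq> 0"
proof -
  define d where "d = degree h"
  define A where "A = (\<Sum>i\<le>d. smult (coeff h i * z ^ i) (monom 1 (d - i) * [:z + 1, 1:] ^ i))"
  define B where "B = pcompose q [:z, 1:]"
  have A_eq: "poly A y = y ^ d * poly h (z * (y + z + 1) / y)" if "y \<noteq> 0" for y
  proof -
    have "poly A y = (\<Sum>i\<le>d. coeff h i * z ^ i * (y ^ (d - i) * (z + 1 + y) ^ i))"
      by (simp add: A_def poly_sum poly_monom)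
    also have "\<dots> = (\<Sum>i\<le>d. y ^ d * (coeff h i * (z * (y + z + 1) / y) ^ i))"
      using that by (intro sum.cong) (auto simp: power_diff power_divide power_mult_distrib add_ac)
    also have "\<dots> = y ^ d * poly h (z * (y + z + 1) / y)"
      by (simp add: poly_altdef d_def sum_distrib_left)
    finally show ?thesis .
  qed
  \<comment> \<open>Only the term \<open>i = d\<close> survives at \<open>y = 0\<close>. Knowing
    that 0 is no zero of \<open>A\<close> permits the division by \<open>y\<close> below.\<close>
  have A0: "poly A 0 \<noteq> 0"
  proof -
    have "poly A 0 = (\<Sum>i\<le>d. if i = d then coeff h i * z ^ i * (z + 1) ^ i else 0)"
      unfolding A_def poly_sum by (intro sum.cong) (auto simp: poly_monom power_0_left add.commute)
    also have "\<dots> = lead_coeff h * z ^ d * (z + 1) ^ d" by (simp add: d_def)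
    finally show ?thesis using h z by (simp add: add_eq_0_iff2)
  qed
  \<comment> \<open>Before scaling, each summand is monic of degree \<open>d\<close> in
    \<open>y\<close>, so the factors \<open>coeff h i * z ^ i\<close> add up to \<open>h(z)\<close>.
    This gives \<open>A * B\<close> degree at least \<open>d\<close>, as
    \<open>coeff_nonzero_halfplane\<close> requires.\<close>
  have Ad: "coeff A d = poly h z"
  proof -
    have "coeff (monom 1 (d - i) * [:z + 1, 1:] ^ i) d = 1" if "i \<le> d" for i
      using that by (simp add: coeff_monom_mult coeff_linear_power)
    then show ?thesis by (simp add: A_def coeff_sum poly_altdef d_def)
  qed
  have "A \<noteq> 0" using A0 by auto
  moreover have "B \<noteq> 0" using q by (simp add: B_def pcompose_eq_0_iff)
  moreover have "d \<le> degree A" using Ad z by (intro le_degree) simp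
  ultimately have deg: "d \<le> degree (A * B)" by (simp add: degree_mult_eq)
  have "Re (w * y) > 0" if "poly (A * B) y = 0" for y
  proof (cases "poly B y = 0")
    case True
    then have "poly q (z + y) = 0" by (simp add: B_def poly_pcompose)
    from qr[OF this] show ?thesis by simp
  next
    case False
    with that have "poly A y = 0" by simp
    with A0 have y: "y \<noteq> 0" by auto
    \<comment> \<open>The point at which \<open>A_eq\<close> evaluates \<open>h\<close>; solving for
      \<open>y\<close> gives the expression in \<open>hr\<close>.\<close>
    define \<beta> where "\<beta> = z * (y + z + 1) / y"
    have "poly h \<beta> = 0" using A_eq[OF y] \<open>poly A y = 0\<close> y by (simp add: \<beta>_def)
    have "z - \<beta> = - (z * (z + 1)) / y"
      using y by (simp add: \<beta>_def field_simps)
    moreover have "z * (z + 1) \<noteq> 0" using z by (simp add: add_eq_0_iff2)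
    ultimately have "- (z * (z + 1)) / (z - \<beta>) = y"
      using y by simp
    with hr \<open>poly h \<beta> = 0\<close> show ?thesis by metis
  qed
  then have "coeff (A * B) d \<noteq> 0" using coeff_nonzero_halfplane deg by blast
  then show ?thesis by (simp add: poly_diamond A_def B_def d_def)
qed

text \<open>Division with remainder gives \<open>z (z + 1) / (z - \<beta>) = z + 1 + \<beta> +
  \<beta> (1 + \<beta>) / (z - \<beta>)\<close>. For \<open>\<beta>\<close> in [-1, 0] the product
  \<open>\<beta> (1 + \<beta>)\<close> is at most 0, so the imaginary part of the last term is 0 or
  has the sign of \<open>Im z\<close>.\<close>

lemma Im_diamond_root:
  assumes "Im z \<noteq> 0" "Im \<beta> = 0" "-1 \<le> Re \<beta>" "Re \<beta> \<le> 0"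
  shows "sgn (Im z) * Im (z * (z + 1) / (z - \<beta>)) > 0"
proof -
  have nz: "z \<noteq> \<beta>" using assms by auto
  have "z * (z + 1) / (z - \<beta>) = z + (1 + \<beta>) + \<beta> * (1 + \<beta>) / (z - \<beta>)"
    using nz by (simp add: field_simps)
  moreover have "\<beta> = of_real (Re \<beta>)" using assms by (simp add: complex_eq_iff)
  ultimately have "Im (z * (z + 1) / (z - \<beta>)) =
      Im z + Im (of_real (Re \<beta> * (1 + Re \<beta>)) / (z - of_real (Re \<beta>)))"
    by (metis (no_types, lifting) Im_complex_of_real add.right_neutral of_real_1 of_real_add of_real_mult plus_complex.sel(2) add.assoc)
  also have "\<dots> = Im z * (1 - Re \<beta> * (1 + Re \<beta>) / ((Re z - Re \<beta>)\<^sup>2 + (Im z)\<^sup>2))"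
    by (simp add: Im_divide diff_divide_distrib add_divide_distrib algebra_simps)
  finally have eq: "Im (z * (z + 1) / (z - \<beta>)) =
      Im z * (1 - Re \<beta> * (1 + Re \<beta>) / ((Re z - Re \<beta>)\<^sup>2 + (Im z)\<^sup>2))" .
  have "Re \<beta> * (1 + Re \<beta>) \<le> 0" using assms by (simp add: mult_nonpos_nonneg)
  then have "Re \<beta> * (1 + Re \<beta>) / ((Re z - Re \<beta>)\<^sup>2 + (Im z)\<^sup>2) \<le> 0"
    by (simp add: divide_nonpos_nonneg)
  then show ?thesis unfolding eq using assms(1)
    by (simp add: sgn_if zero_less_mult_iff mult_less_0_iff)
qed

lemma Re_mult_ii: "Re (of_real s * \<i> * (- X / u)) = s * Im (X / u)"
proof -
  have "of_real s * \<i> * (- X / u) = of_real s * (\<i> * - (X / u))" by simp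
  moreover have "Re (of_real s * (\<i> * - v)) = s * Im v" for v by simp
  ultimately show ?thesis by metis
qed

text \<open>The choice \<open>w = \<i>\<close> describes the open lower half plane. The polynomial
  \<open>q\<close> may have non-real coefficients, as \<open>E(S) + \<i> E(S - x)\<close> does; only
  \<open>h\<close> must have its zeros in [-1, 0].\<close>

lemma diamond_nonzero_upper:
  assumes h: "unit_rooted h" and q: "\<And>\<alpha>. Im \<alpha> > 0 \<Longrightarrow> poly q \<alpha> \<noteq> 0" and z: "Im z > 0"
  shows "poly (diamond h q) z \<noteq> 0"
proof (rule poly_diamond_nonzero[where w = \<i>])
  show "h \<noteq> 0" "poly h z \<noteq> 0" "z \<noteq> 0" "z \<noteq> -1" using h z by (auto simp: unit_rooted_def)
  show "q \<noteq> 0" using q z by fastforce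
  show "Re (\<i> * (- (z * (z + 1)) / (z - \<beta>))) > 0" if "poly h \<beta> = 0" for \<beta>
    using Im_diamond_root[of z \<beta>] Re_mult_ii[of 1 "z * (z + 1)" "z - \<beta>"] that h z
    by (simp add: unit_rooted_def)
  show "Re (\<i> * (\<alpha> - z)) > 0" if "poly q \<alpha> = 0" for \<alpha>
    using q[of \<alpha>] that z by fastforce
qed

lemma unit_rooted_diamond:
  assumes h: "unit_rooted h" and q: "unit_rooted q"
  shows "unit_rooted (diamond h q)"
proof -
  have *: "poly (diamond h q) z \<noteq> 0" if z: "\<not> (Im z = 0 \<and> - 1 \<le> Re z \<and> Re z \<le> 0)" for z
  proof -
    have nz: "h \<noteq> 0" "poly h z \<noteq> 0" "z \<noteq> 0" "z \<noteq> -1" "q \<noteq> 0"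
      using h q z by (auto simp: unit_rooted_def)
    show ?thesis
    proof (cases "Im z = 0")
      case False
      show ?thesis
      \<comment> \<open>This is the open half plane opposite to that of \<open>z\<close>.\<close>
      proof (rule poly_diamond_nonzero[OF nz(1,5,2-4), where w = "of_real (sgn (Im z)) * \<i>"])
        show "Re (of_real (sgn (Im z)) * \<i> * (- (z * (z + 1)) / (z - \<beta>))) > 0"
          if "poly h \<beta> = 0" for \<beta>
          using Im_diamond_root[of z \<beta>] that h False unfolding Re_mult_ii by (simp add: unit_rooted_def)
        show "Re (of_real (sgn (Im z)) * \<i> * (\<alpha> - z)) > 0" if "poly q \<alpha> = 0" for \<alpha>
          using that q False by (auto simp: unit_rooted_def sgn_if)
      qed
    next
      case True
      define t where "t = Re z"
      have zt: "z = of_real t" using True by (simp add: t_def complex_eq_iff)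
      have t: "t < -1 \<or> t > 0" using z True by (auto simp: t_def)
      \<comment> \<open>For real \<open>z\<close> the zeros in \<open>y\<close> are real too,
        negative if \<open>t > 0\<close> and positive if \<open>t < -1\<close>.\<close>
      define s :: real where "s = (if t > 0 then -1 else 1)"
      have sg: "s * (b - t) > 0" if "-1 \<le> b" "b \<le> 0" for b
        using t that by (auto simp: s_def)
      show ?thesis
      proof (rule poly_diamond_nonzero[OF nz(1,5,2-4), where w = "of_real s"])
        show "Re (of_real s * (- (z * (z + 1)) / (z - \<beta>))) > 0" if "poly h \<beta> = 0" for \<beta>
        proof -
          define b where "b = Re \<beta>"
          have b: "\<beta> = of_real b" "-1 \<le> b" "b \<le> 0"
            using h that by (auto simp: unit_rooted_def b_def complex_eq_iff)
          have X: "t * (t + 1) > 0" using t by (auto simp: zero_less_mult_iff)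
          have "s * (- X / (t - b)) > 0" if "X > 0" for X
            using t b that by (auto simp: s_def zero_less_divide_iff divide_less_0_iff)
          from this[OF X] have "s * (- (t * (t + 1)) / (t - b)) > 0" .
          moreover have "of_real s * (- (z * (z + 1)) / (z - \<beta>)) = of_real (s * (- (t * (t + 1)) / (t - b)))"
            by (simp add: zt b)
          ultimately show ?thesis by (metis Re_complex_of_real)
        qed
        show "Re (of_real s * (\<alpha> - z)) > 0" if "poly q \<alpha> = 0" for \<alpha>
          using that q sg by (auto simp: unit_rooted_def t_def)
      qed
    qed
  qed
  moreover have "diamond h q \<noteq> 0" using *[of \<i>] by auto
  ultimately show ?thesis unfolding unit_rooted_def by blast
qed

section \<open>Interlacing and the Hermite-Biehler theorem\<close>

abbreviation cpoly :: "real poly \<Rightarrow> complex poly" where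
  "cpoly \<equiv> map_poly complex_of_real"

lemma cpoly_mult: "cpoly (p * q) = cpoly p * cpoly q"
  by (rule poly_eqI) (simp add: coeff_map_poly coeff_mult)

lemma cpoly_pCons: "cpoly (pCons a p) = pCons (of_real a) (cpoly p)"
  by (simp add: map_poly_pCons)

lemma cpoly_pderiv: "pderiv (cpoly p) = cpoly (pderiv p)"
  by (rule poly_eqI) (simp add: coeff_map_poly coeff_pderiv)

lemma poly_cpoly_of_real: "poly (cpoly p) (of_real t) = of_real (poly p t)"
  by (induction p) (simp_all add: cpoly_pCons)

lemma poly_cpoly_cnj: "poly (cpoly p) (cnj z) = cnj (poly (cpoly p) z)"
  by (induction p) (simp_all add: cpoly_pCons)

lemma degree_cpoly: "degree (cpoly p) = degree p"
  by (simp add: degree_map_poly)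

section \<open>Zeros of real-rooted polynomials as lists\<close>

lemma real_rooted_factor:
  "real_rooted ([:-c, 1:] * p) \<longleftrightarrow> real_rooted p"
proof -
  have "[:-c, 1:] * p = 0 \<longleftrightarrow> p = 0" by (simp only: mult_eq_0_iff) simp
  moreover have "poly (cpoly ([:-c, 1:] * p)) z = (z - of_real c) * poly (cpoly p) z" for z
    unfolding cpoly_mult cpoly_pCons by (simp add: algebra_simps)
  ultimately show ?thesis unfolding real_rooted_def by auto
qed

text \<open>A complex zero exists, is real by hypothesis, and can be split off over the
  reals.\<close>

lemma size_proots_real_rooted:
  "real_rooted p \<Longrightarrow> size (proots p) = degree p"
proof (induction "degree p" arbitrary: p)
  case 0
  then show ?case by (metis size_proots_le le_zero_eq)
next
  case (Suc n)
  then have "\<not> constant (poly (cpoly p))"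
    by (metis constant_degree degree_cpoly nat.distinct(1))
  then obtain z where z: "poly (cpoly p) z = 0"
    using fundamental_theorem_of_algebra by blast
  with Suc.prems obtain t where "z = of_real t"
    unfolding real_rooted_def by (metis Reals_cases)
  with z have "poly p t = 0" by (simp add: poly_cpoly_of_real)
  then obtain q where q: "p = [:-t, 1:] * q" by (metis dvdE poly_eq_0_iff_dvd)
  have "q \<noteq> 0" using Suc.prems q by (auto simp: real_rooted_def)
  then have "degree p = Suc (degree q)" unfolding q by (subst degree_mult_eq) auto
  moreover have "real_rooted q" using Suc.prems unfolding q real_rooted_factor .
  ultimately have "size (proots q) = degree q" using Suc.hyps by simp
  with \<open>q \<noteq> 0\<close> \<open>degree p = Suc (degree q)\<close> show ?case
    unfolding q by (subst proots_mult) auto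
qed

text \<open>The interlacing chain in recursive form, the first list being longer by one; this form
  permits the induction in \<open>alternating_insort\<close>.\<close>

fun alternating :: "real list \<Rightarrow> real list \<Rightarrow> bool" where
  "alternating [a] [] = True"
| "alternating (a # a' # us) (b # bs) = (a \<le> b \<and> b \<le> a' \<and> alternating (a' # us) bs)"
| "alternating _ _ = False"

lemma alternating_iff:
  "alternating us bs \<longleftrightarrow> length us = length bs + 1 \<and>
     (\<forall>i<length bs. us ! i \<le> bs ! i \<and> bs ! i \<le> us ! (i + 1))"
  by (induction us bs rule: alternating.induct) (auto simp: less_Suc_eq_0_disj All_less_Suc2)

text \<open>Alternation makes both lists increasing, so the two copies of \<open>c\<close> become
  neighbours in the merged chain.\<close>

lemma alternating_insort:
  "alternating us bs \<Longrightarrow> alternating (insort c us) (insort c bs)"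
  by (induction us bs rule: alternating.induct) auto

lemma interlaces_iff_alternating:
  "interlaces g f \<longleftrightarrow> real_rooted f \<and> real_rooted g \<and>
     alternating (sorted_list_of_multiset (proots f)) (sorted_list_of_multiset (proots g))"
proof -
  have "length (sorted_list_of_multiset (proots p)) = degree p" if "real_rooted p" for p
    using size_proots_real_rooted[OF that] by (metis mset_sorted_list_of_multiset size_mset)
  then show ?thesis unfolding interlaces_def alternating_iff Let_def by auto
qed

text \<open>Reinstates a common zero that \<open>hermite_biehler\<close> divides out.\<close>

lemma interlaces_factor:
  assumes "interlaces g f"
  shows "interlaces ([:-c, 1:] * g) ([:-c, 1:] * f)"
proof -
  have "sorted_list_of_multiset (proots ([:-c, 1:] * p))
      = insort c (sorted_list_of_multiset (proots p))" if "real_rooted p" for p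
  proof -
    have "proots ([:-c, 1:] * p) = add_mset c (proots p)"
      using that by (subst proots_mult) (auto simp: real_rooted_def)
    then show ?thesis by simp
  qed
  with assms show ?thesis
    by (simp only: interlaces_iff_alternating real_rooted_factor alternating_insort)
qed

text \<open>Every zero lies in the lower half plane, hence is closer to \<open>cnj z\<close> than to
  \<open>z\<close>; the distances multiply.\<close>

lemma norm_cnj_less:
  fixes p :: "complex poly"
  assumes "\<And>\<zeta>. poly p \<zeta> = 0 \<Longrightarrow> Im \<zeta> < 0" and "Im z > 0" and "degree p > 0"
  shows "norm (poly p (cnj z)) < norm (poly p z)"
proof -
  have "(\<forall>\<zeta>. poly p \<zeta> = 0 \<longrightarrow> Im \<zeta> < 0) \<longrightarrow>
    norm (poly p (cnj z)) \<le> norm (poly p z) \<and>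
    (degree p > 0 \<longrightarrow> norm (poly p (cnj z)) < norm (poly p z))"
  proof (induction p rule: complex_poly_factor_induct)
    case (const c)
    then show ?case by simp
  next
    case (factor a p)
    show ?case
    proof
      assume r: "\<forall>\<zeta>. poly ([:-a, 1:] * p) \<zeta> = 0 \<longrightarrow> Im \<zeta> < 0"
      then have le: "norm (poly p (cnj z)) \<le> norm (poly p z)" using factor.IH by simp
      have a: "Im a < 0" using r by simp
      have "(Im z + Im a)\<^sup>2 < (Im z - Im a)\<^sup>2"
        using mult_pos_neg[OF assms(2) a] by (simp add: power2_eq_square algebra_simps)
      then have "norm (cnj z - a) < norm (z - a)"
        by (simp add: cmod_def power2_commute power2_eq_square algebra_simps)
      moreover have "poly p z \<noteq> 0" using r assms(2) by force
      ultimately have "norm (cnj z - a) * norm (poly p z) < norm (z - a) * norm (poly p z)"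
        by (intro mult_strict_right_mono) auto
      moreover have "norm (cnj z - a) * norm (poly p (cnj z)) \<le> norm (cnj z - a) * norm (poly p z)"
        using le by (intro mult_left_mono) auto
      ultimately have "norm (cnj z - a) * norm (poly p (cnj z)) < norm (z - a) * norm (poly p z)"
        by linarith
      then have "norm (poly ([:-a, 1:] * p) (cnj z)) < norm (poly ([:-a, 1:] * p) z)"
        by (simp add: norm_mult[symmetric] algebra_simps)
      then show "norm (poly ([:-a, 1:] * p) (cnj z)) \<le> norm (poly ([:-a, 1:] * p) z) \<and>
        (degree ([:-a, 1:] * p) > 0 \<longrightarrow>
          norm (poly ([:-a, 1:] * p) (cnj z)) < norm (poly ([:-a, 1:] * p) z))"
        by simp
    qed
  qed
  with assms show ?thesis by blast
qed

text \<open>A zero at which the derivative does not vanish has order 1.\<close>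

lemma proots_simple:
  fixes f :: "real poly"
  assumes "f \<noteq> 0" and "\<And>t. poly f t = 0 \<Longrightarrow> poly (pderiv f) t \<noteq> 0"
  shows "proots f = mset_set {t. poly f t = 0}"
proof (rule multiset_eqI)
  fix t
  have "order t f = 1" if "poly f t = 0"
  proof -
    have "order t (pderiv f) = 0" using assms(2)[OF that] by (simp add: order_0I)
    moreover have "order t f \<noteq> 0" using that assms(1) by (simp add: order_root)
    moreover have "pderiv f \<noteq> 0" using assms(2)[OF that] by auto
    ultimately show ?thesis using order_pderiv[OF assms(1) that] by simp
  qed
  moreover have "order t f = 0" if "poly f t \<noteq> 0" using that by (simp add: order_0I)
  ultimately show "count (proots f) t = count (mset_set {t. poly f t = 0}) t"
    using assms(1) poly_roots_finite[OF assms(1)] by (auto simp: count_mset_set')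
qed

text \<open>Otherwise \<open>f / g\<close> would be differentiable between \<open>a\<close> and
  \<open>b\<close>, be 0 at both ends and have positive derivative, against Rolle's theorem.\<close>

lemma wronskian_root_between:
  fixes f g :: "real poly"
  assumes W: "\<And>t. poly (pderiv f) t * poly g t - poly f t * poly (pderiv g) t > 0"
    and ab: "a < b" "poly f a = 0" "poly f b = 0"
  shows "\<exists>t. a < t \<and> t < b \<and> poly g t = 0"
proof (rule ccontr)
  assume none: "\<not> ?thesis"
  have "poly g a \<noteq> 0" "poly g b \<noteq> 0" using W[of a] W[of b] ab by auto
  with none have g: "poly g t \<noteq> 0" if "a \<le> t" "t \<le> b" for t
    using that by (metis order_le_less)
  let ?h = "\<lambda>t. poly f t / poly g t"
  have der: "(?h has_real_derivative
      (poly (pderiv f) t * poly g t - poly f t * poly (pderiv g) t) / (poly g t * poly g t)) (at t)"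
    if "a \<le> t" "t \<le> b" for t
    using g[OF that] by (intro DERIV_divide poly_DERIV)
  have "\<exists>t. a < t \<and> t < b \<and> (?h has_real_derivative 0) (at t)"
  proof (rule Rolle)
    show "a < b" "?h a = ?h b" using ab by simp_all
    show "continuous_on {a..b} ?h" using g by (intro continuous_intros) auto
    show "?h differentiable (at t)" if "a < t" "t < b" for t
      using der[of t] that real_differentiable_def by fastforce
  qed
  then obtain t where t: "a < t" "t < b" and d0: "(?h has_real_derivative 0) (at t)" by blast
  have "(poly (pderiv f) t * poly g t - poly f t * poly (pderiv g) t) / (poly g t * poly g t) = 0"
    using DERIV_unique[OF der d0] t by simp
  with W[of t] g[of t] t show False by simp
qed

text \<open>Let \<open>F = f + \<i> g\<close>. Its logarithmic derivative on the real axis shows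
  that the Wronskian is positive, so the zeros of \<open>f\<close> are simple and separated by zeros
  of \<open>g\<close>. Comparing \<open>F\<close> at conjugate points gives real-rootedness. The
  degrees leave no room for further zeros of \<open>g\<close>.\<close>

lemma hermite_biehler_coprime:
  fixes f g :: "real poly"
  assumes deg: "degree f = degree g + 1" and g0: "g \<noteq> 0"
    and nv: "\<And>z. Im z > 0 \<Longrightarrow> poly (cpoly f) z + \<i> * poly (cpoly g) z \<noteq> 0"
    and cop: "\<And>t. \<not> (poly f t = 0 \<and> poly g t = 0)"
  shows "interlaces g f"
proof -
  define F where "F = cpoly f + smult \<i> (cpoly g)"
  have f0: "f \<noteq> 0" using deg by auto
  have "degree F = degree f"
    unfolding F_def using deg by (subst degree_add_eq_left) (auto simp: degree_cpoly)
  then have degF: "degree F > 0" using deg by simp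
  have F_eq: "poly F z = poly (cpoly f) z + \<i> * poly (cpoly g) z" for z by (simp add: F_def)
  \<comment> \<open>A real zero of \<open>F\<close> would be a common zero of \<open>f\<close> and
    \<open>g\<close>.\<close>
  have rootF: "Im \<zeta> < 0" if "poly F \<zeta> = 0" for \<zeta>
  proof (rule ccontr)
    assume "\<not> Im \<zeta> < 0"
    with nv[of \<zeta>] that have "Im \<zeta> = 0" by (force simp: F_eq)
    then have "\<zeta> = of_real (Re \<zeta>)" by (simp add: complex_eq_iff)
    then have "of_real (poly f (Re \<zeta>)) + \<i> * of_real (poly g (Re \<zeta>)) = 0"
      using that F_eq[of \<zeta>] by (metis poly_cpoly_of_real)
    then show False using cop[of "Re \<zeta>"] by (simp add: complex_eq_iff)
  qed
  have W: "poly (pderiv f) t * poly g t - poly f t * poly (pderiv g) t > 0" for t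
  proof -
    define a b a' b' where ab: "a = poly f t" "b = poly g t"
      "a' = poly (pderiv f) t" "b' = poly (pderiv g) t"
    \<comment> \<open>With the implicit \<open>w = \<i>\<close>, real points lie on the boundary of
      the half plane, where \<open>Re_logderiv_neg\<close> still applies.\<close>
    have "Re (poly (pderiv F) (of_real t) / (\<i> * poly F (of_real t))) < 0"
      using rootF degF by (intro Re_logderiv_neg) auto
    also have "poly (pderiv F) (of_real t) / (\<i> * poly F (of_real t))
        = (of_real a' + \<i> * of_real b') / (\<i> * (of_real a + \<i> * of_real b))"
      by (simp add: F_def pderiv_add pderiv_smult cpoly_pderiv poly_cpoly_of_real ab)
    also have "Re \<dots> = (a * b' - a' * b) / (b\<^sup>2 + a\<^sup>2)"
      by (simp add: Re_divide mult.commute)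
    finally have "a * b' - a' * b < 0"
      by (metis divide_less_0_iff add_nonneg_nonneg zero_le_power2 not_less)
    then show ?thesis by (simp add: ab)
  qed
  have norm_F: "norm (poly F (cnj z)) \<noteq> norm (poly F z)" if "Im z > 0" for z
    using norm_cnj_less[OF rootF that degF] by simp
  have F_cnj: "poly F (cnj z) = cnj (poly (cpoly f) z) + \<i> * cnj (poly (cpoly g) z)" for z
    by (simp add: F_eq poly_cpoly_cnj)
  \<comment> \<open>If \<open>f\<close> or \<open>g\<close> vanishes at \<open>z\<close>, then
    \<open>F\<close> has the same norm at \<open>z\<close> and at \<open>cnj z\<close>.\<close>
  have nf: "poly (cpoly f) z \<noteq> 0" "poly (cpoly g) z \<noteq> 0" if "Im z > 0" for z
    using norm_F[OF that] F_eq[of z] F_cnj[of z] by (auto simp: norm_mult)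
  \<comment> \<open>Non-real zeros of a real polynomial come in conjugate pairs.\<close>
  have rr: "real_rooted p" if "p \<noteq> 0" "\<And>z. Im z > 0 \<Longrightarrow> poly (cpoly p) z \<noteq> 0" for p
  proof -
    have "Im z = 0" if "poly (cpoly p) z = 0" for z
      using \<open>\<And>z. Im z > 0 \<Longrightarrow> poly (cpoly p) z \<noteq> 0\<close>[of z] that
        \<open>\<And>z. Im z > 0 \<Longrightarrow> poly (cpoly p) z \<noteq> 0\<close>[of "cnj z"] by (force simp: poly_cpoly_cnj)
    with that show ?thesis by (auto simp: real_rooted_def complex_is_Real_iff)
  qed
  have rrf: "real_rooted f" and rrg: "real_rooted g" using rr f0 g0 nf by blast+
  define Z where "Z = {t. poly f t = 0}"
  define us where "us = sorted_list_of_set Z"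
  have "finite Z" using f0 poly_roots_finite by (simp add: Z_def)
  have proots_f: "proots f = mset_set Z"
  proof -
    have "poly (pderiv f) t \<noteq> 0" if "poly f t = 0" for t using W[of t] that by auto
    then show ?thesis unfolding Z_def using f0 by (rule proots_simple[rotated])
  qed
  have len: "length us = degree g + 1"
    using size_proots_real_rooted[OF rrf] deg by (simp add: proots_f us_def)
  have us_Z: "poly f (us ! i) = 0" if "i < length us" for i
    using that \<open>finite Z\<close> nth_mem[OF that] by (simp add: us_def Z_def)
  have us_less: "us ! i < us ! j" if "i < j" "j < length us" for i j
    using that strict_sorted_list_of_set[of Z] by (simp add: us_def sorted_wrt_nth_less)
  have "\<exists>t. us ! i < t \<and> t < us ! (i + 1) \<and> poly g t = 0" if "i < degree g" for i
    using that len us_less by (intro wronskian_root_between[OF W]) (auto intro: us_Z)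
  then obtain b where b: "\<And>i. i < degree g \<Longrightarrow> us ! i < b i \<and> b i < us ! (i + 1) \<and> poly g (b i) = 0"
    by metis
  define bs where "bs = map b [0..<degree g]"
  have sorted: "sorted_wrt (<) bs"
    unfolding sorted_wrt_iff_nth_less
  proof (intro allI impI)
    fix i j assume ij: "i < j" "j < length bs"
    then have "j < degree g" by (simp add: bs_def)
    have "us ! (i + 1) \<le> us ! j"
      using us_less[of "i + 1" j] ij len \<open>j < degree g\<close> by (cases "i + 1 = j") auto
    then show "bs ! i < bs ! j" using b[of i] b[of j] ij \<open>j < degree g\<close> by (simp add: bs_def)
  qed
  have "mset bs \<subseteq># proots g"
  proof -
    have "distinct bs" using sorted strict_sorted_iff by blast
    then have "mset bs = mset_set (set bs)" by (simp add: mset_set_set)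
    also have "set bs \<subseteq> set_mset (proots g)" using b g0 by (auto simp: bs_def)
    then have "mset_set (set bs) \<subseteq># mset_set (set_mset (proots g))"
      by (intro subset_imp_msubset_mset_set) auto
    also have "\<dots> \<subseteq># proots g" by (simp add: mset_set_set_mset_msubset)
    finally show ?thesis .
  qed
  \<comment> \<open>There are \<open>degree g\<close> gaps between the zeros of \<open>f\<close>, so
    the zeros of \<open>g\<close> found in them are all its zeros, with multiplicity.\<close>
  moreover have "size (proots g) = size (mset bs)"
    using size_proots_real_rooted[OF rrg] by (simp add: bs_def)
  ultimately have "proots g = mset bs"
    by (metis mset_subset_size order_less_irrefl subset_mset.le_less)
  then have "sorted_list_of_multiset (proots g) = bs"
    using sorted by (simp add: strict_sorted_iff sorted_sort_id)
  moreover have "sorted_list_of_multiset (proots f) = us" by (simp add: proots_f us_def)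
  moreover have "alternating us bs"
    unfolding alternating_iff using len b by (auto simp: bs_def less_imp_le)
  ultimately show ?thesis by (simp add: interlaces_iff_alternating rrf rrg)
qed

text \<open>Common real zeros are divided out one by one until
  \<open>hermite_biehler_coprime\<close> applies; the quotients inherit the absence of zeros in the
  upper half plane.\<close>

theorem hermite_biehler:
  fixes f g :: "real poly"
  assumes "degree f = degree g + 1" and "g \<noteq> 0"
    and "\<And>z. Im z > 0 \<Longrightarrow> poly (cpoly f) z + \<i> * poly (cpoly g) z \<noteq> 0"
  shows "interlaces g f"
  using assms
proof (induction "degree g" arbitrary: f g rule: less_induct)
  case less
  show ?case
  proof (cases "\<exists>c. poly f c = 0 \<and> poly g c = 0")
    case False
    with less.prems show ?thesis by (intro hermite_biehler_coprime) auto
  next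
    case True
    then obtain c where c: "poly f c = 0" "poly g c = 0" by blast
    then obtain f1 g1 where f1: "f = [:-c, 1:] * f1" and g1: "g = [:-c, 1:] * g1"
      by (metis dvdE poly_eq_0_iff_dvd)
    have nz: "f1 \<noteq> 0" "g1 \<noteq> 0" using less.prems f1 g1 by auto
    have dg: "degree g = degree g1 + 1" unfolding g1 using nz by (subst degree_mult_eq) auto
    have df: "degree f = degree f1 + 1" unfolding f1 using nz by (subst degree_mult_eq) auto
    have "poly (cpoly f1) z + \<i> * poly (cpoly g1) z \<noteq> 0" if "Im z > 0" for z
    proof -
      have "poly (cpoly f) z + \<i> * poly (cpoly g) z
        = (z - of_real c) * (poly (cpoly f1) z + \<i> * poly (cpoly g1) z)"
        unfolding f1 g1 cpoly_mult cpoly_pCons by (simp add: algebra_simps)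
      with less.prems(3)[OF that] show ?thesis by auto
    qed
    then have "interlaces g1 f1" using less.hyps[of g1 f1] less.prems(1) dg df nz by simp
    then show ?thesis unfolding f1 g1 by (rule interlaces_factor)
  qed
qed

section \<open>Evaluation in the binomial basis\<close>

text \<open>For an \<open>E\<close>-polynomial this is the order polynomial at \<open>N\<close>, see
  \<open>card_P_partitions\<close>. The bound \<open>N\<close> is enough because
  \<open>N choose k\<close> is 0 for \<open>k > N\<close>.\<close>

definition binom_eval :: "'a::field_char_0 poly \<Rightarrow> nat \<Rightarrow> 'a" where
  "binom_eval p N = (\<Sum>k\<le>N. coeff p k * of_nat (N choose k))"

text \<open>The linear system is triangular: at \<open>N = n\<close> the coefficient
  \<open>n\<close> enters with factor 1, and otherwise only lower ones occur.\<close>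

lemma binom_eval_inject:
  assumes "\<And>N. binom_eval p N = binom_eval q N"
  shows "p = q"
proof (rule poly_eqI)
  fix n show "coeff p n = coeff q n"
  proof (induction n rule: less_induct)
    case (less n)
    then have "(\<Sum>k<n. coeff p k * of_nat (n choose k)) = (\<Sum>k<n. coeff q k * of_nat (n choose k))"
      by simp
    with assms[of n] show ?case
      by (simp add: binom_eval_def lessThan_Suc_atMost[symmetric])
  qed
qed

lemma binom_eval_smult: "binom_eval (smult c p) N = c * binom_eval p N"
  by (simp add: binom_eval_def sum_distrib_left mult_ac)

lemma binom_eval_diff: "binom_eval (p - q) N = binom_eval p N - binom_eval q N"
  by (simp add: binom_eval_def sum_subtractf left_diff_distrib)

lemma binom_eval_sum: "binom_eval (\<Sum>i\<in>I. f i) N = (\<Sum>i\<in>I. binom_eval (f i) N)"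
  by (simp add: binom_eval_def coeff_sum sum_distrib_right sum.swap[of _ I])

text \<open>Since \<open>N (N choose k) = k (N choose k) + (k + 1) (N choose (k + 1))\<close>,
  multiplication by \<open>N\<close> corresponds to sending \<open>x ^ k\<close> to
  \<open>k x ^ k + (k + 1) x ^ (k + 1)\<close>, and this is what the differential operator
  does.\<close>

lemma binom_eval_mult_index:
  "binom_eval ([:0, 1:] * pderiv ([:1, 1:] * p)) N = of_nat N * binom_eval p N"
proof -
  have c: "coeff ([:0, 1:] * pderiv ([:1, 1:] * p)) k =
      of_nat k * coeff p k + (if k = 0 then 0 else of_nat k * coeff p (k - 1))" for k
    by (cases k) (auto simp: coeff_pderiv coeff_pCons algebra_simps split: nat.splits)
  have "(\<Sum>k\<le>N. (if k = 0 then 0 else of_nat k * coeff p (k - 1)) * of_nat (N choose k))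
      = (\<Sum>k<N. of_nat (Suc k) * coeff p k * of_nat (N choose Suc k))"
    by (cases N) (simp_all add: sum.atMost_Suc_shift lessThan_Suc_atMost del: sum.atMost_Suc)
  \<comment> \<open>Absorption gives the shifted terms the weight \<open>N - k\<close>, which adds
    up to \<open>N\<close> with the weight \<open>k\<close> of the other sum.\<close>
  also have "\<dots> = (\<Sum>k<N. of_nat (N - k) * coeff p k * of_nat (N choose k))"
  proof (rule sum.cong[OF refl])
    fix k assume "k \<in> {..<N}"
    have "Suc k * (N choose Suc k) = (N - k) * (N choose k)"
      by (metis binomial_absorb_comp binomial_absorption mult.commute)
    then have "(of_nat (Suc k) :: 'a) * of_nat (N choose Suc k) = of_nat (N - k) * of_nat (N choose k)"
      by (metis of_nat_mult)
    then show "of_nat (Suc k) * coeff p k * of_nat (N choose Suc k)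
        = of_nat (N - k) * coeff p k * of_nat (N choose k)"
      by (metis mult.assoc mult.commute)
  qed
  also have "\<dots> = (\<Sum>k\<le>N. of_nat (N - k) * coeff p k * of_nat (N choose k))"
    by (simp add: lessThan_Suc_atMost[symmetric])
  finally have "binom_eval ([:0, 1:] * pderiv ([:1, 1:] * p)) N =
      (\<Sum>k\<le>N. of_nat k * coeff p k * of_nat (N choose k)) +
      (\<Sum>k\<le>N. of_nat (N - k) * coeff p k * of_nat (N choose k))"
    unfolding binom_eval_def c by (simp add: distrib_right sum.distrib)
  also have "\<dots> = (\<Sum>k\<le>N. of_nat N * (coeff p k * of_nat (N choose k)))"
    unfolding sum.distrib[symmetric] by (intro sum.cong) (auto simp: of_nat_diff algebra_simps)
  finally show ?thesis by (simp add: binom_eval_def sum_distrib_left)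
qed

text \<open>The Leibniz rule stops after two terms, as the second derivative of a linear factor
  vanishes.\<close>

lemma higher_pderiv_linear_mult:
  fixes v :: "'a::field_char_0 poly"
  shows "(pderiv ^^ Suc i) ([:1, 1:] * v)
    = [:1, 1:] * (pderiv ^^ Suc i) v + smult (of_nat (Suc i)) ((pderiv ^^ i) v)"
proof (induction i)
  case 0
  then show ?case by (simp add: pderiv_add pderiv_pCons algebra_simps)
next
  case (Suc i)
  have "(pderiv ^^ Suc (Suc i)) ([:1, 1:] * v)
      = pderiv ([:1, 1:] * (pderiv ^^ Suc i) v + smult (of_nat (Suc i)) ((pderiv ^^ i) v))"
    using Suc by simp
  also have "\<dots> = [:1, 1:] * (pderiv ^^ Suc (Suc i)) v
      + smult (of_nat (Suc (Suc i))) ((pderiv ^^ Suc i) v)"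
  proof -
    have "pderiv [:1, 1:] = (1 :: 'a poly)" by (simp add: pderiv_pCons one_pCons)
    then show ?thesis
      by (simp only: pderiv_add pderiv_mult pderiv_smult funpow.simps comp_apply of_nat_Suc
          smult_add_left smult_1_left mult_1_right add_ac)
  qed
  finally show ?case .
qed

text \<open>Counterpart of \<open>(i + 1) (N choose (i + 1)) = (N - i) (N choose i)\<close>, with
  the operator of \<open>binom_eval_mult_index\<close> in the place of \<open>N\<close>.\<close>

lemma diamond_pow_Suc:
  fixes q :: "'a::field_char_0 poly"
  shows "smult (of_nat (Suc i)) (diamond_pow (Suc i) q)
    = [:0, 1:] * pderiv ([:1, 1:] * diamond_pow i q) - smult (of_nat i) (diamond_pow i q)"
proof -
  define D where "D = (pderiv ^^ i) ([:1, 1:] ^ i * q)"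
  define m :: "'a poly" where "m = monom 1 i"
  have m: "[:0, 1:] * pderiv m = smult (of_nat i) m"
    unfolding m_def pderiv_monom by (cases i) (simp_all add: smult_monom monom_Suc)
  have "smult (of_nat (Suc i)) (diamond_pow (Suc i) q)
      = smult (1 / fact i) (monom 1 (Suc i) * (pderiv ^^ Suc i) ([:1, 1:] * ([:1, 1:] ^ i * q)))"
  proof -
    have "of_nat (Suc i) * (1 / fact (Suc i)) = (1 / fact i :: 'a)" by (simp del: of_nat_Suc)
    then show ?thesis by (simp only: diamond_pow_def smult_smult power_Suc mult.assoc)
  qed
  also have "\<dots> = smult (1 / fact i) ([:0, 1:] * m * ([:1, 1:] * pderiv D + smult (of_nat (Suc i)) D))"
    unfolding higher_pderiv_linear_mult by (simp add: D_def m_def monom_Suc)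
  also have "[:0, 1:] * m * ([:1, 1:] * pderiv D + smult (of_nat (Suc i)) D)
      = [:0, 1:] * pderiv ([:1, 1:] * (m * D)) - smult (of_nat i) (m * D)"
  proof -
    have T: "[:0, 1:] * pderiv ([:1, 1:] * (m * D))
        = [:1, 1:] * ([:0, 1:] * m * pderiv D + [:0, 1:] * pderiv m * D) + [:0, 1:] * (m * D)"
      by (simp only: pderiv_mult) (simp add: pderiv_pCons algebra_simps)
    have Y: "[:1, 1:] = 1 + ([:0, 1:] :: 'a poly)" by (simp add: one_pCons)
    have S: "smult (of_nat (Suc i)) D = D + [:of_nat i:] * D" "smult (of_nat i) p = [:of_nat i:] * p" for p
      by (simp_all add: smult_add_left)
    show ?thesis unfolding T m unfolding Y S by (simp only: algebra_simps mult_1_left)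
  qed
  also have "smult (1 / fact i) \<dots>
      = [:0, 1:] * pderiv ([:1, 1:] * smult (1 / fact i) (m * D)) - smult (of_nat i) (smult (1 / fact i) (m * D))"
    unfolding mult_smult_right pderiv_smult smult_diff_right smult_smult
    by (simp only: mult.commute[of "1 / fact i" "of_nat i"])
  finally show ?thesis unfolding diamond_pow_def D_def m_def .
qed

lemma binom_eval_diamond_pow:
  "binom_eval (diamond_pow i q) N = of_nat (N choose i) * binom_eval q N"
proof (induction i)
  case 0
  then show ?case by (simp add: diamond_pow_def monom_0 one_pCons[symmetric])
next
  case (Suc i)
  have "of_nat (Suc i) * binom_eval (diamond_pow (Suc i) q) N
      = (of_nat N - of_nat i) * (of_nat (N choose i) * binom_eval q N)"
    unfolding binom_eval_smult[symmetric] diamond_pow_Suc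
    by (simp only: binom_eval_diff binom_eval_mult_index binom_eval_smult Suc) (simp add: algebra_simps)
  also have "(of_nat N - of_nat i) * of_nat (N choose i) = (of_nat (Suc i) * of_nat (N choose Suc i) :: 'a)"
  \<comment> \<open>The difference is not truncated here; for \<open>i > N\<close> both binomials
    vanish.\<close>
  proof (cases "i \<le> N")
    case True
    have "Suc i * (N choose Suc i) = (N - i) * (N choose i)"
      by (metis binomial_absorb_comp binomial_absorption mult.commute)
    then show ?thesis using True by (metis of_nat_diff of_nat_mult)
  qed (simp add: binomial_eq_0)
  then have "(of_nat N - of_nat i) * (of_nat (N choose i) * binom_eval q N)
      = of_nat (Suc i) * (of_nat (N choose Suc i) * binom_eval q N)"
    by (metis mult.assoc)
  finally show ?case by (simp del: of_nat_Suc)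
qed

lemma binom_eval_diamond: "binom_eval (diamond h q) N = binom_eval h N * binom_eval q N"
proof -
  have "binom_eval (diamond h q) N = (\<Sum>i\<le>degree h. coeff h i * of_nat (N choose i)) * binom_eval q N"
    by (simp add: diamond_def binom_eval_sum binom_eval_smult binom_eval_diamond_pow
        sum_distrib_right mult.assoc)
  \<comment> \<open>Beyond \<open>degree h\<close> the coefficients vanish, beyond \<open>N\<close>
    the binomials.\<close>
  also have "(\<Sum>i\<le>degree h. coeff h i * of_nat (N choose i))
      = (\<Sum>i\<le>max (degree h) N. coeff h i * of_nat (N choose i))"
    by (intro sum.mono_neutral_left) (auto simp: coeff_eq_0)
  also have "\<dots> = binom_eval h N"
    unfolding binom_eval_def by (intro sum.mono_neutral_right) (auto simp: binomial_eq_0)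
  finally show ?thesis .
qed

section \<open>Counting partitions of composed posets\<close>

definition compatible :: "'a rel \<Rightarrow> ('a \<Rightarrow> nat) \<Rightarrow> ('a \<Rightarrow> nat) \<Rightarrow> bool" where
  "compatible r \<omega> \<sigma> \<longleftrightarrow> (\<forall>x y. (x, y) \<in> r \<longrightarrow> \<sigma> x \<ge> \<sigma> y) \<and>
     (\<forall>x y. (x, y) \<in> r \<and> x \<noteq> y \<and> \<omega> x > \<omega> y \<longrightarrow> \<sigma> x > \<sigma> y)"

text \<open>An arbitrary image \<open>A\<close> allows counting on the upper part of an ordinal sum,
  whose values need not start at 1.\<close>

definition onto_partitions :: "'a set \<Rightarrow> 'a rel \<Rightarrow> ('a \<Rightarrow> nat) \<Rightarrow> nat set \<Rightarrow> ('a \<Rightarrow> nat) set" where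
  "onto_partitions P r \<omega> A = {\<sigma> \<in> extensional P. compatible r \<omega> \<sigma> \<and> \<sigma> ` P = A}"

lemma P_partitions_compatible: "P_partitions P r \<omega> n = {\<sigma> \<in> P \<rightarrow>\<^sub>E {1..n}. compatible r \<omega> \<sigma>}"
  by (simp add: P_partitions_def compatible_def)

lemma surj_count_onto: "surj_count P r \<omega> k = card (onto_partitions P r \<omega> {1..k})"
  unfolding surj_count_def P_partitions_compatible onto_partitions_def
  by (rule arg_cong[where f = card]) (auto simp: PiE_def)

lemma onto_partitions_subset: "onto_partitions P r \<omega> A \<subseteq> P \<rightarrow>\<^sub>E A"
  by (auto simp: onto_partitions_def PiE_def)

lemma finite_onto_partitions: "finite P \<Longrightarrow> finite A \<Longrightarrow> finite (onto_partitions P r \<omega> A)"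
  by (rule finite_subset[OF onto_partitions_subset finite_PiE]) auto

text \<open>Only comparisons between values and between labels matter; this serves relabelling as
  well as monotone changes of the values.\<close>

lemma compatible_cong:
  assumes "r \<subseteq> P \<times> P"
    and "\<And>x y. x \<in> P \<Longrightarrow> y \<in> P \<Longrightarrow> \<sigma> x < \<sigma> y \<longleftrightarrow> \<tau> x < \<tau> y"
    and "\<And>x y. x \<in> P \<Longrightarrow> y \<in> P \<Longrightarrow> \<omega> x < \<omega> y \<longleftrightarrow> \<mu> x < \<mu> y"
  shows "compatible r \<omega> \<sigma> \<longleftrightarrow> compatible r \<mu> \<tau>"
proof -
  have "(\<sigma> y \<le> \<sigma> x \<longleftrightarrow> \<tau> y \<le> \<tau> x) \<and> (\<sigma> y < \<sigma> x \<longleftrightarrow> \<tau> y < \<tau> x) \<and> (\<omega> y < \<omega> x \<longleftrightarrow> \<mu> y < \<mu> x)"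
    if "(x, y) \<in> r" for x y
  proof -
    have "x \<in> P" "y \<in> P" using that assms(1) by auto
    then show ?thesis using assms(2,3) by (simp add: not_less[symmetric])
  qed
  then show ?thesis unfolding compatible_def by blast
qed

lemma compatible_restrict:
  "r \<subseteq> P \<times> P \<Longrightarrow> compatible r \<omega> (restrict \<sigma> P) \<longleftrightarrow> compatible r \<omega> \<sigma>"
  by (rule compatible_cong) auto

lemma compatible_strict_mono:
  assumes r: "r \<subseteq> P \<times> P" and h: "strict_mono_on B h" and \<sigma>: "\<sigma> ` P \<subseteq> B"
  shows "compatible r \<omega> (restrict (h \<circ> \<sigma>) P) \<longleftrightarrow> compatible r \<omega> \<sigma>"
proof (rule compatible_cong[OF r])
  fix x y assume "x \<in> P" "y \<in> P"
  moreover from this have "\<sigma> x \<in> B" "\<sigma> y \<in> B" using \<sigma> by auto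
  ultimately show "restrict (h \<circ> \<sigma>) P x < restrict (h \<circ> \<sigma>) P y \<longleftrightarrow> \<sigma> x < \<sigma> y"
    using h by (simp add: strict_mono_on_less)
qed (rule refl)

text \<open>Composition with an increasing map is a bijection, inverted by composition with
  \<open>inv_into B h\<close>.\<close>

lemma card_onto_partitions_image:
  assumes r: "r \<subseteq> P \<times> P" and h: "strict_mono_on B h"
  shows "card (onto_partitions P r \<omega> (h ` B)) = card (onto_partitions P r \<omega> B)"
proof -
  have inj: "inj_on h B" using h by (rule strict_mono_on_imp_inj_on)
  have "bij_betw (\<lambda>\<sigma>. restrict (h \<circ> \<sigma>) P) (onto_partitions P r \<omega> B) (onto_partitions P r \<omega> (h ` B))"
  proof (rule bij_betw_byWitness[where f' = "\<lambda>\<tau>. restrict (inv_into B h \<circ> \<tau>) P"])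
    show "\<forall>\<sigma>\<in>onto_partitions P r \<omega> B. restrict (inv_into B h \<circ> restrict (h \<circ> \<sigma>) P) P = \<sigma>"
      using inj by (auto simp: onto_partitions_def fun_eq_iff extensional_def)
    show inv: "\<forall>\<tau>\<in>onto_partitions P r \<omega> (h ` B). restrict (h \<circ> restrict (inv_into B h \<circ> \<tau>) P) P = \<tau>"
      by (auto simp: onto_partitions_def fun_eq_iff extensional_def)
        (metis f_inv_into_f imageI)
    show "(\<lambda>\<sigma>. restrict (h \<circ> \<sigma>) P) ` onto_partitions P r \<omega> B \<subseteq> onto_partitions P r \<omega> (h ` B)"
      using compatible_strict_mono[OF r h] by (auto simp: onto_partitions_def image_comp)
    show "(\<lambda>\<tau>. restrict (inv_into B h \<circ> \<tau>) P) ` onto_partitions P r \<omega> (h ` B) \<subseteq> onto_partitions P r \<omega> B"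
    proof (rule image_subsetI)
      fix \<tau> assume \<tau>: "\<tau> \<in> onto_partitions P r \<omega> (h ` B)"
      let ?\<sigma> = "restrict (inv_into B h \<circ> \<tau>) P"
      have "?\<sigma> ` P = inv_into B h ` (\<tau> ` P)" by (simp add: image_comp)
      also have "\<dots> = B" using \<tau> inj by (simp add: onto_partitions_def inv_into_image_cancel)
      finally have im: "?\<sigma> ` P = B" .
      have "compatible r \<omega> (restrict (h \<circ> ?\<sigma>) P)" using inv \<tau> by (simp add: onto_partitions_def)
      then have "compatible r \<omega> ?\<sigma>" using compatible_strict_mono[OF r h] im by blast
      with im show "?\<sigma> \<in> onto_partitions P r \<omega> B" by (simp add: onto_partitions_def)
    qed
  qed
  then show ?thesis by (simp add: bij_betw_same_card)
qed

text \<open>The increasing enumeration of \<open>A\<close> standardises the values.\<close>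

lemma card_onto_partitions:
  assumes "r \<subseteq> P \<times> P" "finite A"
  shows "card (onto_partitions P r \<omega> A) = surj_count P r \<omega> (card A)"
proof -
  obtain h where "bij_betw h {..<card A} A" "strict_mono_on {..<card A} h"
    using ex_bij_betw_strict_mono_card[OF \<open>finite A\<close>] .
  then have "card (onto_partitions P r \<omega> A) = card (onto_partitions P r \<omega> {..<card A})"
    using card_onto_partitions_image[OF assms(1)] by (metis bij_betw_imp_surj_on)
  \<comment> \<open>The enumeration starts at 0, the parts start at 1.\<close>
  also have "\<dots> = card (onto_partitions P r \<omega> (Suc ` {..<card A}))"
    by (rule card_onto_partitions_image[OF assms(1), symmetric]) (simp add: strict_mono_on_def)
  also have "Suc ` {..<card A} = {1..card A}" by (simp add: image_Suc_lessThan)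
  finally show ?thesis by (simp add: surj_count_onto)
qed

section \<open>Coefficients, degree and binomial values of the \<open>E\<close>-polynomial\<close>

lemma surj_count_gt:
  assumes "finite P" "k > card P"
  shows "surj_count P r \<omega> k = 0"
proof -
  have "\<sigma> ` P \<noteq> {1..k}" for \<sigma>
    using card_image_le[OF assms(1), of \<sigma>] assms(2) by auto
  then have "onto_partitions P r \<omega> {1..k} = {}" by (simp add: onto_partitions_def)
  then show ?thesis by (simp add: surj_count_onto)
qed

lemma surj_count_0: "P \<noteq> {} \<Longrightarrow> surj_count P r \<omega> 0 = 0"
  by (simp add: surj_count_onto onto_partitions_def)

text \<open>Being valid for all \<open>k\<close> and for the empty poset, this spares the later
  convolutions a treatment of ranges.\<close>

lemma coeff_E_poly:
  assumes "finite P" "r \<subseteq> P \<times> P"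
  shows "coeff (E_poly P r \<omega>) k = real (surj_count P r \<omega> k)"
proof (cases "P = {}")
  case True
  then have "compatible r \<omega> \<sigma>" for \<sigma> using assms(2) by (simp add: compatible_def)
  \<comment> \<open>The single function on the empty carrier is onto the empty set, in accordance
    with \<open>E = 1\<close>.\<close>
  then have "onto_partitions P r \<omega> {1..k} = (if k = 0 then {\<lambda>_. undefined} else {})"
    using True by (auto simp: onto_partitions_def)
  then show ?thesis using True by (simp add: E_poly_def surj_count_onto)
next
  case False
  then have "coeff (E_poly P r \<omega>) k = (\<Sum>j = 1..card P. if j = k then real (surj_count P r \<omega> j) else 0)"
    by (simp add: E_poly_def coeff_sum)
  also have "\<dots> = (if k \<in> {1..card P} then real (surj_count P r \<omega> k) else 0)" by simp
  also have "\<dots> = real (surj_count P r \<omega> k)"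
    using surj_count_0[OF False] surj_count_gt[OF assms(1)] by (cases "k = 0") auto
  finally show ?thesis .
qed

text \<open>Ranking the elements first by the size of their up-sets and then by their labels is a
  linear extension.\<close>

lemma surj_count_card_pos:
  assumes "labelled_poset P r \<omega>"
  shows "surj_count P r \<omega> (card P) > 0"
proof -
  have fin: "finite P" and r: "r \<subseteq> P \<times> P" and tr: "trans r" and an: "antisym r"
    and re: "refl_on P r" and inj: "inj_on \<omega> P"
    using assms by (auto simp: labelled_poset_def order_on_defs)
  \<comment> \<open>Larger than every label, so that \<open>\<sigma>\<close> below orders by
    \<open>u\<close> first and by label second.\<close>
  define M where "M = Suc (sum \<omega> P)"
  define u where "u x = card {y. (x, y) \<in> r}" for x
  define \<sigma> where "\<sigma> x = u x * M + \<omega> x" for x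
  have lt: "\<omega> x < M" if "x \<in> P" for x
    using that fin by (simp add: M_def le_imp_less_Suc member_le_sum)
  have "inj_on \<sigma> P"
  proof (rule inj_onI)
    fix x y assume xy: "x \<in> P" "y \<in> P" "\<sigma> x = \<sigma> y"
    then have "\<sigma> x mod M = \<sigma> y mod M" by simp
    then have "\<omega> x = \<omega> y" using lt xy by (simp add: \<sigma>_def)
    then show "x = y" using inj xy by (simp add: inj_on_eq_iff)
  qed
  moreover have "\<sigma> x > \<sigma> y" if "(x, y) \<in> r" "x \<noteq> y" for x y
  proof -
    have "{z. (y, z) \<in> r} \<subset> {z. (x, z) \<in> r}"
    proof
      show "{z. (y, z) \<in> r} \<subseteq> {z. (x, z) \<in> r}" using that tr by (auto dest: transD)
      have "x \<in> {z. (x, z) \<in> r}" "x \<notin> {z. (y, z) \<in> r}"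
        using that r re an by (auto dest: refl_onD antisymD)
      then show "{z. (y, z) \<in> r} \<noteq> {z. (x, z) \<in> r}" by blast
    qed
    moreover have "finite {z. (x, z) \<in> r}"
      by (rule finite_subset[OF _ fin]) (use r in auto)
    ultimately have "u y < u x" unfolding u_def by (simp add: psubset_card_mono)
    then have "u y * M + M \<le> u x * M" by (metis Suc_leI add.commute mult_Suc mult_le_mono1)
    then show ?thesis using lt[of y] r that by (auto simp: \<sigma>_def)
  qed
  then have "compatible r \<omega> \<sigma>" unfolding compatible_def by (metis less_imp_le order_refl)
  then have "restrict \<sigma> P \<in> onto_partitions P r \<omega> (\<sigma> ` P)"
    using compatible_restrict[OF r] by (auto simp: onto_partitions_def)
  then have "card (onto_partitions P r \<omega> (\<sigma> ` P)) > 0"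
    using fin finite_onto_partitions by (metis card_gt_0_iff empty_iff finite_imageI)
  ultimately show ?thesis using card_onto_partitions[OF r] fin by (simp add: card_image)
qed

text \<open>The coefficient at \<open>card P\<close> counts linear extensions and is positive by
  \<open>surj_count_card_pos\<close>.\<close>

lemma degree_E_poly:
  assumes "labelled_poset P r \<omega>"
  shows "degree (E_poly P r \<omega>) = card P" "E_poly P r \<omega> \<noteq> 0"
proof -
  have fin: "finite P" "r \<subseteq> P \<times> P"
    using assms by (auto simp: labelled_poset_def order_on_defs)
  have nz: "coeff (E_poly P r \<omega>) (card P) \<noteq> 0"
    using surj_count_card_pos[OF assms] fin by (simp add: coeff_E_poly)
  moreover have "degree (E_poly P r \<omega>) \<le> card P"
    by (rule degree_le) (use fin in \<open>simp add: coeff_E_poly surj_count_gt\<close>)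
  ultimately show "degree (E_poly P r \<omega>) = card P" by (simp add: le_antisym le_degree)
  show "E_poly P r \<omega> \<noteq> 0" using nz by auto
qed

lemma E_poly_relabel:
  assumes r: "r \<subseteq> P \<times> P" and "\<And>x y. x \<in> P \<Longrightarrow> y \<in> P \<Longrightarrow> \<omega> x < \<omega> y \<longleftrightarrow> \<mu> x < \<mu> y"
  shows "E_poly P r \<omega> = E_poly P r \<mu>"
proof -
  have "compatible r \<omega> \<sigma> \<longleftrightarrow> compatible r \<mu> \<sigma>" for \<sigma>
    by (rule compatible_cong) (use assms in auto)
  then show ?thesis by (simp add: E_poly_def surj_count_onto onto_partitions_def)
qed

text \<open>Partitions are grouped by their image: each of the \<open>n choose k\<close> sets of
  size \<open>k\<close> is the image of \<open>surj_count P r \<omega> k\<close> partitions.\<close>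

lemma card_P_partitions:
  assumes fin: "finite P" and r: "r \<subseteq> P \<times> P"
  shows "of_nat (card (P_partitions P r \<omega> n)) = binom_eval (cpoly (E_poly P r \<omega>)) n"
proof -
  have "P_partitions P r \<omega> n = (\<Union>A\<in>Pow {1..n}. onto_partitions P r \<omega> A)"
    by (auto simp: P_partitions_compatible onto_partitions_def PiE_def)
  then have "card (P_partitions P r \<omega> n) = (\<Sum>A\<in>Pow {1..n}. card (onto_partitions P r \<omega> A))"
  proof (simp only:, intro card_UN_disjoint ballI)
    show "finite (onto_partitions P r \<omega> A)" if "A \<in> Pow {1..n}" for A
      using that fin by (intro finite_onto_partitions) (auto intro: finite_subset)
  qed (auto simp: onto_partitions_def)
  also have "\<dots> = (\<Sum>A\<in>Pow {1..n}. surj_count P r \<omega> (card A))"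
    by (intro sum.cong card_onto_partitions r refl) (auto intro: finite_subset)
  also have "\<dots> = (\<Sum>k\<le>n. \<Sum>A | A \<in> Pow {1..n} \<and> card A = k. surj_count P r \<omega> (card A))"
  proof (rule sum.group[symmetric])
    show "card ` Pow {1..n} \<subseteq> {..n}" using card_mono[of "{1..n}"] by fastforce
  qed auto
  also have "\<dots> = (\<Sum>k\<le>n. surj_count P r \<omega> k * (n choose k))"
  proof (rule sum.cong[OF refl])
    fix k
    have "card {A. A \<in> Pow {1..n} \<and> card A = k} = n choose k"
      using n_subsets[of "{1..n}" k] by simp
    then show "(\<Sum>A | A \<in> Pow {1..n} \<and> card A = k. surj_count P r \<omega> (card A))
        = surj_count P r \<omega> k * (n choose k)" by simp
  qed
  finally show ?thesis
    by (simp add: binom_eval_def coeff_map_poly coeff_E_poly[OF fin r])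
qed

section \<open>Partitions on the union of two disjoint carriers\<close>

definition glue :: "'a set \<Rightarrow> ('a \<Rightarrow> nat) set \<Rightarrow> 'a set \<Rightarrow> ('a \<Rightarrow> nat) set \<Rightarrow> ('a \<Rightarrow> nat) set" where
  "glue P A Q B = {\<sigma> \<in> extensional (P \<union> Q). restrict \<sigma> P \<in> A \<and> restrict \<sigma> Q \<in> B}"

lemma bij_betw_glue:
  assumes "P \<inter> Q = {}" "A \<subseteq> extensional P" "B \<subseteq> extensional Q"
  shows "bij_betw (\<lambda>\<sigma>. (restrict \<sigma> P, restrict \<sigma> Q)) (glue P A Q B) (A \<times> B)"
proof (rule bij_betw_byWitness[where f' = "\<lambda>(\<sigma>, \<tau>) x. if x \<in> P then \<sigma> x else \<tau> x"])
  have *: "restrict (\<lambda>x. if x \<in> P then \<sigma> x else \<tau> x) P = \<sigma>"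
    "restrict (\<lambda>x. if x \<in> P then \<sigma> x else \<tau> x) Q = \<tau>"
    "(\<lambda>x. if x \<in> P then \<sigma> x else \<tau> x) \<in> extensional (P \<union> Q)" if "\<sigma> \<in> A" "\<tau> \<in> B" for \<sigma> \<tau>
    using that assms by (force simp: fun_eq_iff extensional_def restrict_def)+
  show "\<forall>p\<in>A \<times> B. (\<lambda>\<sigma>. (restrict \<sigma> P, restrict \<sigma> Q)) ((\<lambda>(\<sigma>, \<tau>) x. if x \<in> P then \<sigma> x else \<tau> x) p) = p"
    using * by auto
  show "(\<lambda>(\<sigma>, \<tau>) x. if x \<in> P then \<sigma> x else \<tau> x) ` (A \<times> B) \<subseteq> glue P A Q B"
    using * by (auto simp: glue_def)
qed (auto simp: glue_def fun_eq_iff extensional_def)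

lemma card_glue:
  assumes "P \<inter> Q = {}" "A \<subseteq> extensional P" "B \<subseteq> extensional Q"
  shows "card (glue P A Q B) = card A * card B"
  using bij_betw_same_card[OF bij_betw_glue[OF assms]] by (simp add: card_cartesian_product)

lemma finite_glue:
  assumes "P \<inter> Q = {}" "A \<subseteq> extensional P" "B \<subseteq> extensional Q" "finite A" "finite B"
  shows "finite (glue P A Q B)"
  using bij_betw_finite[OF bij_betw_glue[OF assms(1-3)]] assms by simp

lemma compatible_Un: "compatible (r \<union> s) \<mu> \<sigma> \<longleftrightarrow> compatible r \<mu> \<sigma> \<and> compatible s \<mu> \<sigma>"
  unfolding compatible_def by blast

text \<open>A partition of the union with parts at most \<open>n\<close> is an arbitrary pair of
  such partitions, so the values of \<open>binom_eval\<close> multiply, as they do for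
  \<open>diamond\<close>.\<close>

lemma E_poly_disjoint_union:
  assumes fin: "finite P" "finite Q" and rs: "r \<subseteq> P \<times> P" "s \<subseteq> Q \<times> Q" and disj: "P \<inter> Q = {}"
  shows "cpoly (E_poly (P \<union> Q) (r \<union> s) \<mu>) = diamond (cpoly (E_poly P r \<mu>)) (cpoly (E_poly Q s \<mu>))"
proof (rule binom_eval_inject)
  fix n
  have "P_partitions (P \<union> Q) (r \<union> s) \<mu> n = glue P (P_partitions P r \<mu> n) Q (P_partitions Q s \<mu> n)"
    by (auto simp: P_partitions_compatible glue_def compatible_Un compatible_restrict[OF rs(1)]
        compatible_restrict[OF rs(2)] PiE_def Pi_def)
  then have "card (P_partitions (P \<union> Q) (r \<union> s) \<mu> n)
      = card (P_partitions P r \<mu> n) * card (P_partitions Q s \<mu> n)"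
    by (simp only:) (rule card_glue[OF disj], auto simp: P_partitions_compatible PiE_def)
  then show "binom_eval (cpoly (E_poly (P \<union> Q) (r \<union> s) \<mu>)) n
      = binom_eval (diamond (cpoly (E_poly P r \<mu>)) (cpoly (E_poly Q s \<mu>))) n"
    unfolding binom_eval_diamond using fin rs
    by (subst (1 2 3) card_P_partitions[symmetric]) auto
qed

text \<open>A surjective partition of an ordinal sum maps \<open>Q\<close> onto an initial segment \<open>{1..j}\<close> and \<open>P\<close>
  onto the values above \<open>j\<close>, possibly together with \<open>j\<close> itself.\<close>

lemma card_glue_layers:
  fixes \<mu> :: "'a \<Rightarrow> nat"
  assumes fin: "finite P" "finite Q" and rs: "r \<subseteq> P \<times> P" "s \<subseteq> Q \<times> Q" and disj: "P \<inter> Q = {}"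
    and "finite J" and A: "\<And>j. finite (A j)"
  defines "G \<equiv> \<lambda>j. glue P (onto_partitions P r \<mu> (A j)) Q (onto_partitions Q s \<mu> {1..j})"
  shows "card (\<Union>j\<in>J. G j) = (\<Sum>j\<in>J. surj_count P r \<mu> (card (A j)) * surj_count Q s \<mu> j)"
proof -
  have ext: "onto_partitions P r \<mu> (A j) \<subseteq> extensional P"
    "onto_partitions Q s \<mu> {1..j} \<subseteq> extensional Q" for j
    by (auto simp: onto_partitions_def)
  have finG: "finite (G j)" for j
    unfolding G_def by (intro finite_glue disj ext finite_onto_partitions fin A) auto
  have cardG: "card (G j) = surj_count P r \<mu> (card (A j)) * surj_count Q s \<mu> j" for j
    unfolding G_def using card_glue[OF disj ext] card_onto_partitions[OF rs(1) A]
    by (simp add: surj_count_onto)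
  have "G i \<inter> G j = {}" if "i \<noteq> j" for i j
  proof -
    have "{1..i} \<noteq> {1..j}" using that by (metis card_atLeastAtMost diff_Suc_1)
    then show ?thesis by (auto simp: G_def glue_def onto_partitions_def)
  qed
  then show "card (\<Union>j\<in>J. G j) = (\<Sum>j\<in>J. surj_count P r \<mu> (card (A j)) * surj_count Q s \<mu> j)"
    using \<open>finite J\<close> finG by (subst card_UN_disjoint) (auto simp: cardG)
qed

lemma split_interval:
  fixes L U :: "nat set"
  assumes un: "U \<union> L = {1..k}" and lt: "\<And>l u. l \<in> L \<Longrightarrow> u \<in> U \<Longrightarrow> l < u"
  shows "\<exists>j\<le>k. L = {1..j} \<and> U = {j + 1..k}"
proof -
  \<comment> \<open>The default 0 fits an empty \<open>L\<close>, which is then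
    \<open>{1..0}\<close>.\<close>
  define j where "j = (if L = {} then 0 else Max L)"
  have "finite L" using un by (metis finite_Un finite_atLeastAtMost)
  then have max: "l \<le> j" if "l \<in> L" for l using that by (auto simp: j_def)
  have jL: "j \<in> L" if "j \<noteq> 0" using that \<open>finite L\<close> by (auto simp: j_def split: if_splits)
  have "j \<le> k" using jL un by (cases "j = 0") auto
  moreover have "L = {1..j}"
  proof
    show "L \<subseteq> {1..j}" using un max by auto
    show "{1..j} \<subseteq> L"
    proof
      fix i assume i: "i \<in> {1..j}"
      then have "i \<in> U \<union> L" unfolding un using \<open>j \<le> k\<close> by simp
      then show "i \<in> L" using lt[OF jL, of i] i by auto
    qed
  qed
  moreover have "U = {j + 1..k}"
  proof
    show "U \<subseteq> {j + 1..k}"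
    proof
      fix i assume i: "i \<in> U"
      moreover from i have "i \<in> {1..k}" using un by blast
      ultimately have "j < i" using lt[OF jL, of i] by (cases "j = 0") auto
      then show "i \<in> {j + 1..k}" using \<open>i \<in> {1..k}\<close> by auto
    qed
    show "{j + 1..k} \<subseteq> U" using un \<open>L = {1..j}\<close> by auto
  qed
  ultimately show ?thesis by blast
qed

text \<open>The common element is the maximum of \<open>L\<close> and the minimum of
  \<open>U\<close>.\<close>

lemma split_interval_shared:
  fixes L U :: "nat set"
  assumes un: "U \<union> L = {1..k}" and le: "\<And>l u. l \<in> L \<Longrightarrow> u \<in> U \<Longrightarrow> l \<le> u" and j: "j \<in> L" "j \<in> U"
  shows "L = {1..j}" "U = {j..k}"
proof -
  have "\<And>l. l \<in> L \<Longrightarrow> l \<le> j" "\<And>u. u \<in> U \<Longrightarrow> j \<le> u" using le j by blast+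
  moreover have "\<And>i. i \<in> U \<union> L \<longleftrightarrow> 1 \<le> i \<and> i \<le> k" using un by simp
  ultimately show "L = {1..j}" "U = {j..k}" using j
    by (auto simp: set_eq_iff) (metis Un_iff le_antisym le_trans nat_le_linear)+
qed

text \<open>If \<open>Q\<close> is mapped onto \<open>{1..j}\<close>, the remaining
  \<open>k - j\<close> values form the image of \<open>P\<close>.\<close>

lemma surj_count_ordinal_sum_strict:
  assumes fin: "finite P" "finite Q" and rs: "r \<subseteq> P \<times> P" "s \<subseteq> Q \<times> Q" and disj: "P \<inter> Q = {}"
  shows "card {\<sigma> \<in> extensional (P \<union> Q). compatible r \<mu> \<sigma> \<and> compatible s \<mu> \<sigma> \<and>
      (\<forall>x\<in>P. \<forall>y\<in>Q. \<sigma> x > \<sigma> y) \<and> \<sigma> ` (P \<union> Q) = {1..k}}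
    = (\<Sum>j\<le>k. surj_count P r \<mu> (k - j) * surj_count Q s \<mu> j)" (is "card ?X = _")
proof -
  have "?X = (\<Union>j\<in>{..k}. glue P (onto_partitions P r \<mu> {j + 1..k}) Q (onto_partitions Q s \<mu> {1..j}))"
    (is "_ = ?Y")
  proof (intro equalityI subsetI)
    fix \<sigma> assume \<sigma>: "\<sigma> \<in> ?X"
    then have "\<exists>j\<le>k. \<sigma> ` Q = {1..j} \<and> \<sigma> ` P = {j + 1..k}"
      by (intro split_interval) (auto simp: image_Un)
    then obtain j where "j \<le> k" "\<sigma> ` Q = {1..j}" "\<sigma> ` P = {j + 1..k}" by blast
    with \<sigma>
    show "\<sigma> \<in> ?Y"
      by (auto simp: glue_def onto_partitions_def compatible_restrict[OF rs(1)] compatible_restrict[OF rs(2)])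
  next
    fix \<sigma> assume "\<sigma> \<in> ?Y"
    then obtain j where j: "j \<le> k" "\<sigma> ` Q = {1..j}" "\<sigma> ` P = {j + 1..k}"
      and \<sigma>: "\<sigma> \<in> extensional (P \<union> Q)" "compatible r \<mu> \<sigma>" "compatible s \<mu> \<sigma>"
      by (auto simp: glue_def onto_partitions_def compatible_restrict[OF rs(1)] compatible_restrict[OF rs(2)])
    have "\<sigma> ` (P \<union> Q) = {1..k}" unfolding image_Un j using j(1) by auto
    moreover have "\<sigma> y < \<sigma> x" if "x \<in> P" "y \<in> Q" for x y
    proof -
      have "\<sigma> x \<in> {j + 1..k}" "\<sigma> y \<in> {1..j}" using that j by blast+
      then show ?thesis by simp
    qed
    ultimately show "\<sigma> \<in> ?X" using \<sigma> by blast
  qed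
  then show ?thesis
    using card_glue_layers[OF fin rs disj, of "{..k}" "\<lambda>j. {j + 1..k}"] by simp
qed

text \<open>The shared value \<open>j\<close> belongs to both images, so that of \<open>P\<close> is
  \<open>{j..k}\<close>, of size \<open>k + 1 - j\<close>.\<close>

lemma surj_count_ordinal_sum_shared:
  assumes fin: "finite P" "finite Q" and rs: "r \<subseteq> P \<times> P" "s \<subseteq> Q \<times> Q" and disj: "P \<inter> Q = {}"
  shows "card {\<sigma> \<in> extensional (P \<union> Q). compatible r \<mu> \<sigma> \<and> compatible s \<mu> \<sigma> \<and>
      (\<forall>x\<in>P. \<forall>y\<in>Q. \<sigma> x \<ge> \<sigma> y) \<and> (\<exists>x\<in>P. \<exists>y\<in>Q. \<sigma> x = \<sigma> y) \<and> \<sigma> ` (P \<union> Q) = {1..k}}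
    = (\<Sum>j=1..k. surj_count P r \<mu> (k + 1 - j) * surj_count Q s \<mu> j)" (is "card ?X = _")
proof -
  have "?X = (\<Union>j\<in>{1..k}. glue P (onto_partitions P r \<mu> {j..k}) Q (onto_partitions Q s \<mu> {1..j}))"
    (is "_ = ?Y")
  proof (intro equalityI subsetI)
    fix \<sigma> assume \<sigma>: "\<sigma> \<in> ?X"
    then obtain x y where xy: "x \<in> P" "y \<in> Q" "\<sigma> x = \<sigma> y" by blast
    have "\<sigma> x \<in> {1..k}" using \<sigma> xy by blast
    have un: "\<sigma> ` P \<union> \<sigma> ` Q = {1..k}" using \<sigma> by (simp add: image_Un)
    have le: "l \<le> u" if "l \<in> \<sigma> ` Q" "u \<in> \<sigma> ` P" for l u using \<sigma> that by auto
    have "\<sigma> x \<in> \<sigma> ` Q" using xy(2) unfolding xy(3) by (rule imageI)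
    moreover have "\<sigma> x \<in> \<sigma> ` P" using xy(1) by (rule imageI)
    ultimately have *: "\<sigma> ` Q = {1..\<sigma> x}" "\<sigma> ` P = {\<sigma> x..k}"
      using split_interval_shared[OF un le] by blast+
    with \<sigma> \<open>\<sigma> x \<in> {1..k}\<close> show "\<sigma> \<in> ?Y"
      by (auto simp: glue_def onto_partitions_def compatible_restrict[OF rs(1)] compatible_restrict[OF rs(2)])
  next
    fix \<sigma> assume "\<sigma> \<in> ?Y"
    then obtain j where j: "1 \<le> j" "j \<le> k" "\<sigma> ` Q = {1..j}" "\<sigma> ` P = {j..k}"
      and \<sigma>: "\<sigma> \<in> extensional (P \<union> Q)" "compatible r \<mu> \<sigma>" "compatible s \<mu> \<sigma>"
      by (auto simp: glue_def onto_partitions_def compatible_restrict[OF rs(1)] compatible_restrict[OF rs(2)])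
    have "\<sigma> ` (P \<union> Q) = {1..k}" unfolding image_Un j using j(1,2) by auto
    moreover have "\<sigma> y \<le> \<sigma> x" if "x \<in> P" "y \<in> Q" for x y
    proof -
      have "\<sigma> x \<in> {j..k}" "\<sigma> y \<in> {1..j}" using that j by blast+
      then show ?thesis by simp
    qed
    moreover have "j \<in> \<sigma> ` P" "j \<in> \<sigma> ` Q" using j by auto
    then have "\<exists>x\<in>P. \<exists>y\<in>Q. \<sigma> x = \<sigma> y" by (metis imageE)
    ultimately show "\<sigma> \<in> ?X" using \<sigma> by blast
  qed
  then show ?thesis
    using card_glue_layers[OF fin rs disj, of "{1..k}" "\<lambda>j. {j..k}"] by simp
qed

section \<open>Product formulas for ordinal sums\<close>

lemma compatible_ordinal_sum1:
  assumes "P \<inter> Q = {}" "\<And>x y. x \<in> Q \<Longrightarrow> y \<in> P \<Longrightarrow> \<mu> x < \<mu> y"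
  shows "compatible (ordinal_sum P r Q s) \<mu> \<sigma> \<longleftrightarrow>
    compatible r \<mu> \<sigma> \<and> compatible s \<mu> \<sigma> \<and> (\<forall>x\<in>P. \<forall>y\<in>Q. \<sigma> x > \<sigma> y)"
proof -
  have "compatible (P \<times> Q) \<mu> \<sigma> \<longleftrightarrow> (\<forall>x\<in>P. \<forall>y\<in>Q. \<sigma> x > \<sigma> y)"
    using assms unfolding compatible_def by (auto simp: less_imp_le) blast
  then show ?thesis by (simp add: ordinal_sum_def compatible_Un)
qed

text \<open>Labels increase from \<open>P\<close> to \<open>Q\<close>, so the relations in
  \<open>P \<times> Q\<close> impose only weak inequalities.\<close>

lemma compatible_ordinal_sum0:
  assumes "\<And>x y. x \<in> P \<Longrightarrow> y \<in> Q \<Longrightarrow> \<mu> x < \<mu> y"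
  shows "compatible (ordinal_sum P r Q s) \<mu> \<sigma> \<longleftrightarrow>
    compatible r \<mu> \<sigma> \<and> compatible s \<mu> \<sigma> \<and> (\<forall>x\<in>P. \<forall>y\<in>Q. \<sigma> x \<ge> \<sigma> y)"
proof -
  have "compatible (P \<times> Q) \<mu> \<sigma> \<longleftrightarrow> (\<forall>x\<in>P. \<forall>y\<in>Q. \<sigma> x \<ge> \<sigma> y)"
    using assms unfolding compatible_def by (auto dest: less_asym)
  then show ?thesis by (simp add: ordinal_sum_def compatible_Un)
qed

lemma coeff_E_poly_mult:
  assumes fin: "finite P" "finite Q" and rs: "r \<subseteq> P \<times> P" "s \<subseteq> Q \<times> Q"
  shows "coeff (E_poly P r \<mu> * E_poly Q s \<mu>) k
    = real (\<Sum>j\<le>k. surj_count P r \<mu> (k - j) * surj_count Q s \<mu> j)"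
proof -
  have "coeff (E_poly P r \<mu> * E_poly Q s \<mu>) k
      = (\<Sum>j\<le>k. coeff (E_poly Q s \<mu>) j * coeff (E_poly P r \<mu>) (k - j))"
    by (subst mult.commute) (rule coeff_mult)
  then show ?thesis by (simp add: coeff_E_poly fin rs mult.commute)
qed

text \<open>All inequalities across the sum are strict, so the counts are exactly the convolution
  defining the product.\<close>

lemma E_poly_ordinal_sum1:
  assumes fin: "finite P" "finite Q" and rs: "r \<subseteq> P \<times> P" "s \<subseteq> Q \<times> Q" and disj: "P \<inter> Q = {}"
    and \<mu>: "\<And>x y. x \<in> Q \<Longrightarrow> y \<in> P \<Longrightarrow> \<mu> x < \<mu> y"
  shows "E_poly (P \<union> Q) (ordinal_sum P r Q s) \<mu> = E_poly P r \<mu> * E_poly Q s \<mu>"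
proof (rule poly_eqI)
  fix k
  have "ordinal_sum P r Q s \<subseteq> (P \<union> Q) \<times> (P \<union> Q)" using rs by (auto simp: ordinal_sum_def)
  then have "coeff (E_poly (P \<union> Q) (ordinal_sum P r Q s) \<mu>) k
      = real (card (onto_partitions (P \<union> Q) (ordinal_sum P r Q s) \<mu> {1..k}))"
    using fin by (simp add: coeff_E_poly surj_count_onto)
  also have "onto_partitions (P \<union> Q) (ordinal_sum P r Q s) \<mu> {1..k} =
    {\<sigma> \<in> extensional (P \<union> Q). compatible r \<mu> \<sigma> \<and> compatible s \<mu> \<sigma> \<and>
      (\<forall>x\<in>P. \<forall>y\<in>Q. \<sigma> x > \<sigma> y) \<and> \<sigma> ` (P \<union> Q) = {1..k}}"
    using compatible_ordinal_sum1[of P Q \<mu>, OF disj \<mu>] by (auto simp: onto_partitions_def)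
  finally show "coeff (E_poly (P \<union> Q) (ordinal_sum P r Q s) \<mu>) k = coeff (E_poly P r \<mu> * E_poly Q s \<mu>) k"
    unfolding surj_count_ordinal_sum_strict[OF fin rs disj] coeff_E_poly_mult[OF fin rs] .
qed

text \<open>Partitions without a shared value contribute the coefficient \<open>k\<close> of the
  product, those with one the coefficient \<open>k + 1\<close>. Hence the factor
  \<open>1 + 1 / x\<close>, stated with the denominator cleared.\<close>

lemma E_poly_ordinal_sum0:
  assumes fin: "finite P" "finite Q" and rs: "r \<subseteq> P \<times> P" "s \<subseteq> Q \<times> Q" and disj: "P \<inter> Q = {}"
    and ne: "P \<noteq> {}" "Q \<noteq> {}" and \<mu>: "\<And>x y. x \<in> P \<Longrightarrow> y \<in> Q \<Longrightarrow> \<mu> x < \<mu> y"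
  shows "[:0, 1:] * E_poly (P \<union> Q) (ordinal_sum P r Q s) \<mu> = [:1, 1:] * (E_poly P r \<mu> * E_poly Q s \<mu>)"
proof (rule poly_eqI)
  fix n
  let ?c = "\<lambda>k. \<Sum>j\<le>k. surj_count P r \<mu> (k - j) * surj_count Q s \<mu> j"
  let ?E = "E_poly (P \<union> Q) (ordinal_sum P r Q s) \<mu>"
  have sub: "ordinal_sum P r Q s \<subseteq> (P \<union> Q) \<times> (P \<union> Q)" using rs by (auto simp: ordinal_sum_def)
  have E: "coeff ?E k = real (?c k) + real (?c (Suc k))" for k
  proof -
    let ?S = "{\<sigma> \<in> extensional (P \<union> Q). compatible r \<mu> \<sigma> \<and> compatible s \<mu> \<sigma> \<and>
      (\<forall>x\<in>P. \<forall>y\<in>Q. \<sigma> x > \<sigma> y) \<and> \<sigma> ` (P \<union> Q) = {1..k}}"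
    let ?T = "{\<sigma> \<in> extensional (P \<union> Q). compatible r \<mu> \<sigma> \<and> compatible s \<mu> \<sigma> \<and>
      (\<forall>x\<in>P. \<forall>y\<in>Q. \<sigma> x \<ge> \<sigma> y) \<and> (\<exists>x\<in>P. \<exists>y\<in>Q. \<sigma> x = \<sigma> y) \<and> \<sigma> ` (P \<union> Q) = {1..k}}"
    have or: "(\<forall>x\<in>P. \<forall>y\<in>Q. \<sigma> x \<ge> \<sigma> y) \<longleftrightarrow> (\<forall>x\<in>P. \<forall>y\<in>Q. \<sigma> x > \<sigma> y) \<or>
        (\<forall>x\<in>P. \<forall>y\<in>Q. \<sigma> x \<ge> \<sigma> y) \<and> (\<exists>x\<in>P. \<exists>y\<in>Q. \<sigma> x = \<sigma> y)" for \<sigma> :: "'a \<Rightarrow> nat"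
      by (metis less_imp_le order_le_less)
    have c0: "compatible (ordinal_sum P r Q s) \<mu> \<sigma> \<longleftrightarrow>
        compatible r \<mu> \<sigma> \<and> compatible s \<mu> \<sigma> \<and> (\<forall>x\<in>P. \<forall>y\<in>Q. \<sigma> x \<ge> \<sigma> y)" for \<sigma>
      using \<mu> by (rule compatible_ordinal_sum0)
    have eq: "onto_partitions (P \<union> Q) (ordinal_sum P r Q s) \<mu> {1..k} = ?S \<union> ?T"
    proof (intro set_eqI)
      fix \<sigma>
      have "(G \<longleftrightarrow> A \<or> (G \<and> B)) \<Longrightarrow>
          (e \<and> (c \<and> d \<and> G) \<and> i) \<longleftrightarrow> (e \<and> c \<and> d \<and> A \<and> i) \<or> (e \<and> c \<and> d \<and> G \<and> B \<and> i)"
        for e c d i G A B by blast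
      from this[OF or] show "\<sigma> \<in> onto_partitions (P \<union> Q) (ordinal_sum P r Q s) \<mu> {1..k} \<longleftrightarrow> \<sigma> \<in> ?S \<union> ?T"
        unfolding onto_partitions_def c0 mem_Collect_eq Un_iff .
    qed
    have "finite (onto_partitions (P \<union> Q) (ordinal_sum P r Q s) \<mu> {1..k})"
      using fin by (simp add: finite_onto_partitions)
    then have "card (?S \<union> ?T) = card ?S + card ?T"
      unfolding eq by (intro card_Un_disjoint) (auto, metis less_irrefl)
    also have "card ?S = ?c k" by (rule surj_count_ordinal_sum_strict[OF fin rs disj])
    also have "card ?T = (\<Sum>j=1..k. surj_count P r \<mu> (k + 1 - j) * surj_count Q s \<mu> j)"
      by (rule surj_count_ordinal_sum_shared[OF fin rs disj])
    \<comment> \<open>The added terms \<open>j = 0\<close> and \<open>j = k + 1\<close> vanish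
      because \<open>Q\<close> and \<open>P\<close> are nonempty.\<close>
    also have "\<dots> = ?c (Suc k)"
      by (rule sum.mono_neutral_cong_left) (auto simp: surj_count_0 ne le_Suc_eq not_le)
    finally have "surj_count (P \<union> Q) (ordinal_sum P r Q s) \<mu> k = ?c k + ?c (Suc k)"
      unfolding surj_count_onto[of "P \<union> Q" "ordinal_sum P r Q s"] eq .
    then show ?thesis using fin by (simp only: coeff_E_poly[OF _ sub] finite_Un of_nat_add)
  qed
  show "coeff ([:0, 1:] * ?E) n = coeff ([:1, 1:] * (E_poly P r \<mu> * E_poly Q s \<mu>)) n"
  proof (cases n)
    case 0
    then show ?thesis using coeff_E_poly[OF fin(1) rs(1)] surj_count_0[OF ne(1)]
      by (simp add: coeff_mult)
  next
    case (Suc k)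
    have "coeff ([:0, 1:] * ?E) n = coeff ?E k" by (simp add: Suc)
    moreover have "coeff ([:1, 1:] * p) n = coeff p (Suc k) + coeff p k" for p :: "real poly"
      by (simp add: Suc)
    ultimately show ?thesis by (simp only: E coeff_E_poly_mult[OF fin rs])
  qed
qed

section \<open>Series-parallel posets\<close>

lemma E_poly_singleton: "E_poly {a} {(a, a)} \<mu> = [:0, 1:]"
proof -
  have "labelled_poset {a} {(a, a)} \<mu>"
    by (rule series_parallel_labelled_poset) (rule series_parallel.single)
  then have "surj_count {a} {(a, a)} \<mu> 1 \<noteq> 0" using surj_count_card_pos by force
  moreover have "surj_count {a} {(a, a)} \<mu> 1 \<le> 1"
  proof -
    have "onto_partitions {a} {(a, a)} \<mu> {1..1} \<subseteq> {\<lambda>x. if x = a then 1 else undefined}"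
      by (auto simp: onto_partitions_def extensional_def)
    from card_mono[OF _ this] show ?thesis by (simp add: surj_count_onto)
  qed
  ultimately have "surj_count {a} {(a, a)} \<mu> 1 = 1" by linarith
  then show ?thesis by (simp add: E_poly_def monom_Suc)
qed

abbreviation E_val :: "'a set \<Rightarrow> 'a rel \<Rightarrow> ('a \<Rightarrow> nat) \<Rightarrow> complex \<Rightarrow> complex" where
  "E_val P r \<omega> z \<equiv> poly (cpoly (E_poly P r \<omega>)) z"

text \<open>By \<open>hermite_biehler\<close>, the second conjunct amounts to \<open>E(P - x) \<preceq> E(P)\<close> for all \<open>x\<close> in \<open>P\<close>.\<close>

definition E_stable :: "'a set \<Rightarrow> 'a rel \<Rightarrow> ('a \<Rightarrow> nat) \<Rightarrow> bool" where
  "E_stable P r \<omega> \<longleftrightarrow> unit_rooted (cpoly (E_poly P r \<omega>)) \<and>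
     (\<forall>x\<in>P. \<forall>z. Im z > 0 \<longrightarrow> E_val P r \<omega> z + \<i> * E_val (P - {x}) (Restr r (P - {x})) \<omega> z \<noteq> 0)"

lemma E_stableD:
  assumes "E_stable P r \<omega>"
  shows "unit_rooted (cpoly (E_poly P r \<omega>))"
    and "x \<in> P \<Longrightarrow> Im z > 0 \<Longrightarrow> E_val P r \<omega> z + \<i> * E_val (P - {x}) (Restr r (P - {x})) \<omega> z \<noteq> 0"
  using assms by (auto simp: E_stable_def)

lemma E_stable_relabel:
  assumes "E_stable P r \<omega>" and r: "r \<subseteq> P \<times> P" and "inj_on \<omega> P" "inj_on \<mu> P"
    and "\<forall>x\<in>P. \<forall>y\<in>P. \<omega> x < \<omega> y \<longrightarrow> \<mu> x < \<mu> y"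
  shows "E_stable P r \<mu>"
proof -
  \<comment> \<open>The injective \<open>\<omega>\<close> orders any two distinct elements, which
    turns the implication into an equivalence.\<close>
  have iff: "\<omega> x < \<omega> y \<longleftrightarrow> \<mu> x < \<mu> y" if "x \<in> P" "y \<in> P" for x y
    using assms that by (metis inj_on_eq_iff linorder_neqE_nat order.asym)
  have "E_poly P r \<omega> = E_poly P r \<mu>" using r iff by (rule E_poly_relabel)
  moreover have "E_poly (P - {x}) (Restr r (P - {x})) \<omega> = E_poly (P - {x}) (Restr r (P - {x})) \<mu>" for x
    by (rule E_poly_relabel) (use iff in auto)
  ultimately show ?thesis using assms(1) by (simp add: E_stable_def)
qed

lemma E_val_nonzero: "E_stable P r \<omega> \<Longrightarrow> Im z > 0 \<Longrightarrow> E_val P r \<omega> z \<noteq> 0"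
  by (auto simp: E_stable_def unit_rooted_def)

text \<open>Made for products of \<open>q\<close> and \<open>q'\<close>, possibly with the extra
  factor \<open>(z + 1) / z\<close>.\<close>

lemma unit_rootedI:
  assumes "p \<noteq> 0" "\<And>z. poly p z = 0 \<Longrightarrow> z = 0 \<or> z = -1 \<or> poly q z = 0 \<or> poly q' z = 0"
    "unit_rooted q" "unit_rooted q'"
  shows "unit_rooted p"
  unfolding unit_rooted_def
proof (intro conjI assms(1) allI impI)
  fix z assume "poly p z = 0"
  then have "z = 0 \<or> z = -1 \<or> poly q z = 0 \<or> poly q' z = 0" by (rule assms(2))
  then have "Im z = 0 \<and> -1 \<le> Re z \<and> Re z \<le> 0"
    using assms(3,4) by (auto simp: unit_rooted_def)
  then show "Im z = 0" "-1 \<le> Re z" "Re z \<le> 0" by auto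
qed

text \<open>Only the order of the labels matters, so both parts can carry the labelling of the whole.\<close>

locale poset_pair =
  fixes P :: "'a set" and r :: "'a rel" and Q :: "'a set" and s :: "'a rel" and \<mu> :: "'a \<Rightarrow> nat"
  assumes fin: "finite P" "finite Q" and rs: "r \<subseteq> P \<times> P" "s \<subseteq> Q \<times> Q" and disj: "P \<inter> Q = {}"
    and stable: "E_stable P r \<mu>" "E_stable Q s \<mu>"
begin

text \<open>Reduces deletion from \<open>Q\<close> in a disjoint union to deletion from
  \<open>P\<close>.\<close>

lemma pair_swap: "poset_pair Q s P r \<mu>"
  using fin rs disj stable by unfold_locales auto

lemma Restr_left: "Restr r (P - {x}) \<subseteq> (P - {x}) \<times> (P - {x})" by auto

lemma Restr_osum_left:
  assumes "x \<in> P"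
  shows "Restr (ordinal_sum P r Q s) (P \<union> Q - {x}) = ordinal_sum (P - {x}) (Restr r (P - {x})) Q s"
    and "Restr (r \<union> s) (P \<union> Q - {x}) = Restr r (P - {x}) \<union> s"
    and "P \<union> Q - {x} = (P - {x}) \<union> Q"
  using assms rs disj by (auto simp: ordinal_sum_def)

lemma Restr_osum_right:
  assumes "x \<in> Q"
  shows "Restr (ordinal_sum P r Q s) (P \<union> Q - {x}) = ordinal_sum P r (Q - {x}) (Restr s (Q - {x}))"
    and "P \<union> Q - {x} = P \<union> (Q - {x})"
  using assms rs disj by (auto simp: ordinal_sum_def)

text \<open>By linearity in the right argument \<open>E(P) + \<i> E(P - x)\<close> enters as a
  single right factor; the left factor is \<open>E(Q)\<close>, with zeros in [-1, 0].\<close>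

lemma disjoint_union_nonzero:
  assumes x: "x \<in> P" and z: "Im z > 0"
  shows "E_val (P \<union> Q) (r \<union> s) \<mu> z + \<i> * E_val (P \<union> Q - {x}) (Restr (r \<union> s) (P \<union> Q - {x})) \<mu> z \<noteq> 0"
proof -
  let ?q = "cpoly (E_poly P r \<mu>) + smult \<i> (cpoly (E_poly (P - {x}) (Restr r (P - {x})) \<mu>))"
  let ?h = "cpoly (E_poly Q s \<mu>)"
  have "cpoly (E_poly (P \<union> Q) (r \<union> s) \<mu>) = diamond ?h (cpoly (E_poly P r \<mu>))"
    using E_poly_disjoint_union[OF fin(2,1) rs(2,1)] disj by (simp add: Un_commute Int_commute)
  moreover have "cpoly (E_poly (P \<union> Q - {x}) (Restr (r \<union> s) (P \<union> Q - {x})) \<mu>)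
      = diamond ?h (cpoly (E_poly (P - {x}) (Restr r (P - {x})) \<mu>))"
    unfolding Restr_osum_left(1,2)[OF x] unfolding Restr_osum_left(3)[OF x]
    using E_poly_disjoint_union[OF fin(2) _ rs(2) Restr_left, of x] fin(1) disj
    by (simp add: Un_commute Int_commute Diff_Int_distrib)
  ultimately have "E_val (P \<union> Q) (r \<union> s) \<mu> z + \<i> * E_val (P \<union> Q - {x}) (Restr (r \<union> s) (P \<union> Q - {x})) \<mu> z
      = poly (diamond ?h ?q) z"
    by (simp add: diamond_add_right diamond_smult_right)
  moreover have "poly (diamond ?h ?q) z \<noteq> 0"
    using E_stableD(2)[OF stable(1) x] z by (intro diamond_nonzero_upper E_stableD(1)[OF stable(2)]) auto
  ultimately show ?thesis by simp
qed

lemma E_stable_disjoint_union: "E_stable (P \<union> Q) (r \<union> s) \<mu>"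
  unfolding E_stable_def
proof (intro conjI ballI allI impI)
  show "unit_rooted (cpoly (E_poly (P \<union> Q) (r \<union> s) \<mu>))"
    unfolding E_poly_disjoint_union[OF fin rs disj] by (intro unit_rooted_diamond E_stableD(1) stable)
  show "E_val (P \<union> Q) (r \<union> s) \<mu> z + \<i> * E_val (P \<union> Q - {x}) (Restr (r \<union> s) (P \<union> Q - {x})) \<mu> z \<noteq> 0"
    if "x \<in> P \<union> Q" "Im z > 0" for x z
  proof (cases "x \<in> P")
    case True
    then show ?thesis using that(2) by (rule disjoint_union_nonzero)
  next
    case False
    with that have "x \<in> Q" by simp
    from poset_pair.disjoint_union_nonzero[OF pair_swap this that(2)] show ?thesis
      by (simp only: Un_commute simp_thms)
  qed
qed

lemma E_val_ordinal_sum1: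
  assumes \<mu>: "\<forall>x\<in>Q. \<forall>y\<in>P. \<mu> x < \<mu> y"
  shows "E_val (P \<union> Q) (ordinal_sum P r Q s) \<mu> z = E_val P r \<mu> z * E_val Q s \<mu> z"
    and "x \<in> P \<Longrightarrow> E_val (P \<union> Q - {x}) (Restr (ordinal_sum P r Q s) (P \<union> Q - {x})) \<mu> z
      = E_val (P - {x}) (Restr r (P - {x})) \<mu> z * E_val Q s \<mu> z"
    and "x \<in> Q \<Longrightarrow> E_val (P \<union> Q - {x}) (Restr (ordinal_sum P r Q s) (P \<union> Q - {x})) \<mu> z
      = E_val P r \<mu> z * E_val (Q - {x}) (Restr s (Q - {x})) \<mu> z"
proof -
  \<comment> \<open>One formula for subposets covers the whole sum and deletion on either
    side.\<close>
  have *: "E_val (P' \<union> Q') (ordinal_sum P' r' Q' s') \<mu> z = E_val P' r' \<mu> z * E_val Q' s' \<mu> z"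
    if "P' \<subseteq> P" "Q' \<subseteq> Q" "r' \<subseteq> P' \<times> P'" "s' \<subseteq> Q' \<times> Q'" for P' Q' r' s'
  proof -
    have "E_poly (P' \<union> Q') (ordinal_sum P' r' Q' s') \<mu> = E_poly P' r' \<mu> * E_poly Q' s' \<mu>"
    proof (rule E_poly_ordinal_sum1)
      show "\<mu> x < \<mu> y" if "x \<in> Q'" "y \<in> P'" for x y
        using \<mu> that \<open>P' \<subseteq> P\<close> \<open>Q' \<subseteq> Q\<close> by blast
    qed (use that fin disj in \<open>auto intro: finite_subset\<close>)
    then show ?thesis by (simp add: cpoly_mult)
  qed
  show "E_val (P \<union> Q) (ordinal_sum P r Q s) \<mu> z = E_val P r \<mu> z * E_val Q s \<mu> z"
    using rs by (intro *) auto
  show "E_val (P \<union> Q - {x}) (Restr (ordinal_sum P r Q s) (P \<union> Q - {x})) \<mu> z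
      = E_val (P - {x}) (Restr r (P - {x})) \<mu> z * E_val Q s \<mu> z" if "x \<in> P"
    unfolding Restr_osum_left(1,2)[OF that] unfolding Restr_osum_left(3)[OF that] using rs by (intro *) auto
  show "E_val (P \<union> Q - {x}) (Restr (ordinal_sum P r Q s) (P \<union> Q - {x})) \<mu> z
      = E_val P r \<mu> z * E_val (Q - {x}) (Restr s (Q - {x})) \<mu> z" if "x \<in> Q"
    unfolding Restr_osum_right(1)[OF that] unfolding Restr_osum_right(2)[OF that] using rs by (intro *) auto
qed

text \<open>The polynomial of the untouched summand factors out and has no zero in the upper half
  plane.\<close>

lemma E_stable_ordinal_sum1:
  assumes \<mu>: "\<forall>x\<in>Q. \<forall>y\<in>P. \<mu> x < \<mu> y"
  shows "E_stable (P \<union> Q) (ordinal_sum P r Q s) \<mu>"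
  unfolding E_stable_def
proof (intro conjI ballI allI impI)
  note val = E_val_ordinal_sum1[OF \<mu>]
  show "unit_rooted (cpoly (E_poly (P \<union> Q) (ordinal_sum P r Q s) \<mu>))"
  proof (rule unit_rootedI)
    show "cpoly (E_poly (P \<union> Q) (ordinal_sum P r Q s) \<mu>) \<noteq> 0"
      using val(1)[of \<i>] E_val_nonzero[OF stable(1), of \<i>] E_val_nonzero[OF stable(2), of \<i>] by auto
    show "unit_rooted (cpoly (E_poly P r \<mu>))" "unit_rooted (cpoly (E_poly Q s \<mu>))"
      using stable by (auto dest: E_stableD)
  qed (simp add: val(1))
  show "E_val (P \<union> Q) (ordinal_sum P r Q s) \<mu> z
      + \<i> * E_val (P \<union> Q - {x}) (Restr (ordinal_sum P r Q s) (P \<union> Q - {x})) \<mu> z \<noteq> 0"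
    if "x \<in> P \<union> Q" and z: "Im z > 0" for x z
  proof (cases "x \<in> P")
    case True
    have "(E_val P r \<mu> z + \<i> * E_val (P - {x}) (Restr r (P - {x})) \<mu> z) * E_val Q s \<mu> z \<noteq> 0"
      using E_stableD(2)[OF stable(1) True z] E_val_nonzero[OF stable(2) z] by simp
    then show ?thesis unfolding val(1) val(2)[OF True] by (simp add: algebra_simps)
  next
    case False
    with that have x: "x \<in> Q" by simp
    have "E_val P r \<mu> z * (E_val Q s \<mu> z + \<i> * E_val (Q - {x}) (Restr s (Q - {x})) \<mu> z) \<noteq> 0"
      using E_stableD(2)[OF stable(2) x z] E_val_nonzero[OF stable(1) z] by simp
    then show ?thesis unfolding val(1) val(3)[OF x] by (simp add: algebra_simps)
  qed
qed

end

text \<open>For deletions that empty a summand, where \<open>E_poly_ordinal_sum0\<close> does not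
  apply to the remaining poset.\<close>

lemma E_poly_at_singleton:
  "P - {x} = {} \<Longrightarrow> x \<in> P \<Longrightarrow> r \<subseteq> P \<times> P \<Longrightarrow> refl_on P r \<Longrightarrow> E_val P r \<mu> z = z"
proof -
  assume *: "P - {x} = {}" "x \<in> P" "r \<subseteq> P \<times> P" "refl_on P r"
  then have "P = {x}" by auto
  moreover have "r = {(x, x)}" using * \<open>P = {x}\<close> by (auto simp: refl_on_def)
  ultimately show ?thesis by (simp add: E_poly_singleton cpoly_pCons)
qed

context poset_pair
begin

lemma E_val_ordinal_sum0:
  assumes \<mu>: "\<forall>x\<in>P. \<forall>y\<in>Q. \<mu> x < \<mu> y"
    and "P' \<subseteq> P" "Q' \<subseteq> Q" "r' \<subseteq> P' \<times> P'" "s' \<subseteq> Q' \<times> Q'" "P' \<noteq> {}" "Q' \<noteq> {}"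
  shows "z * E_val (P' \<union> Q') (ordinal_sum P' r' Q' s') \<mu> z = (z + 1) * (E_val P' r' \<mu> z * E_val Q' s' \<mu> z)"
proof -
  have "[:0, 1:] * E_poly (P' \<union> Q') (ordinal_sum P' r' Q' s') \<mu> = [:1, 1:] * (E_poly P' r' \<mu> * E_poly Q' s' \<mu>)"
    using assms fin disj by (intro E_poly_ordinal_sum0) (auto intro: finite_subset)
  then have "poly (cpoly ([:0, 1:] * E_poly (P' \<union> Q') (ordinal_sum P' r' Q' s') \<mu>)) z
      = poly (cpoly ([:1, 1:] * (E_poly P' r' \<mu> * E_poly Q' s' \<mu>))) z" by (simp only:)
  then show ?thesis unfolding cpoly_mult cpoly_pCons by (simp add: algebra_simps)
qed

text \<open>After multiplication by \<open>z\<close>, the factor \<open>z + 1\<close> and the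
  polynomial of the untouched summand split off. If the deletion empties a summand, the expression
  is instead \<open>z + 1 + \<i>\<close> times the polynomial of the other one.\<close>

lemma E_stable_ordinal_sum0:
  assumes \<mu>: "\<forall>x\<in>P. \<forall>y\<in>Q. \<mu> x < \<mu> y" and ne: "P \<noteq> {}" "Q \<noteq> {}"
    and refl: "refl_on P r" "refl_on Q s"
  shows "E_stable (P \<union> Q) (ordinal_sum P r Q s) \<mu>"
  unfolding E_stable_def
proof (intro conjI ballI allI impI)
  have val: "z * E_val (P \<union> Q) (ordinal_sum P r Q s) \<mu> z = (z + 1) * (E_val P r \<mu> z * E_val Q s \<mu> z)" for z
    using rs ne by (intro E_val_ordinal_sum0[OF \<mu>]) auto
  show "unit_rooted (cpoly (E_poly (P \<union> Q) (ordinal_sum P r Q s) \<mu>))"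
  proof (rule unit_rootedI)
    have "\<i> + 1 \<noteq> 0" by (simp add: complex_eq_iff)
    then show "cpoly (E_poly (P \<union> Q) (ordinal_sum P r Q s) \<mu>) \<noteq> 0"
      using val[of \<i>] E_val_nonzero[OF stable(1), of \<i>] E_val_nonzero[OF stable(2), of \<i>] by auto
    show "unit_rooted (cpoly (E_poly P r \<mu>))" "unit_rooted (cpoly (E_poly Q s \<mu>))"
      using stable by (auto dest: E_stableD)
    show "z = 0 \<or> z = -1 \<or> E_val P r \<mu> z = 0 \<or> E_val Q s \<mu> z = 0"
      if "E_val (P \<union> Q) (ordinal_sum P r Q s) \<mu> z = 0" for z
      using val[of z] that by (auto simp: add_eq_0_iff2)
  qed
  fix x z assume x: "x \<in> P \<union> Q" and z: "Im z > 0"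
  let ?E = "E_val (P \<union> Q) (ordinal_sum P r Q s) \<mu> z"
  let ?D = "E_val (P \<union> Q - {x}) (Restr (ordinal_sum P r Q s) (P \<union> Q - {x})) \<mu> z"
  have nz: "z \<noteq> 0" "z + 1 \<noteq> 0" "z + 1 + \<i> \<noteq> 0" using z by (auto simp: complex_eq_iff)
  note EP = E_val_nonzero[OF stable(1) z] and EQ = E_val_nonzero[OF stable(2) z]
  have "z * (?E + \<i> * ?D) \<noteq> 0"
  proof (cases "x \<in> P")
    case xP: True
    show ?thesis
    proof (cases "P - {x} = {}")
      case True
      have "?D = E_val Q s \<mu> z"
        unfolding Restr_osum_left(1,2)[OF xP] unfolding Restr_osum_left(3)[OF xP]
        unfolding True by (simp add: ordinal_sum_def)
      moreover have "E_val P r \<mu> z = z" by (rule E_poly_at_singleton[OF True xP rs(1) refl(1)])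
      ultimately have "z * (?E + \<i> * ?D) = z * ((z + 1 + \<i>) * E_val Q s \<mu> z)"
        using val[of z] by (simp add: algebra_simps)
      then show ?thesis using nz EQ by simp
    next
      case False
      let ?R = "E_val (P - {x}) (Restr r (P - {x})) \<mu> z"
      have "z * ?D = (z + 1) * (?R * E_val Q s \<mu> z)"
        unfolding Restr_osum_left(1,2)[OF xP] unfolding Restr_osum_left(3)[OF xP]
        using rs ne False by (intro E_val_ordinal_sum0[OF \<mu>]) auto
      with val[of z] have "z * (?E + \<i> * ?D) = (z + 1) * ((E_val P r \<mu> z + \<i> * ?R) * E_val Q s \<mu> z)"
        by (simp add: algebra_simps)
      then show ?thesis using nz EQ E_stableD(2)[OF stable(1) xP z] by simp
    qed
  next
    case False
    with x have xQ: "x \<in> Q" by simp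
    show ?thesis
    proof (cases "Q - {x} = {}")
      case True
      have "?D = E_val P r \<mu> z"
        unfolding Restr_osum_right(1)[OF xQ] unfolding Restr_osum_right(2)[OF xQ]
        unfolding True by (simp add: ordinal_sum_def)
      moreover have "E_val Q s \<mu> z = z" by (rule E_poly_at_singleton[OF True xQ rs(2) refl(2)])
      ultimately have "z * (?E + \<i> * ?D) = z * ((z + 1 + \<i>) * E_val P r \<mu> z)"
        using val[of z] by (simp add: algebra_simps)
      then show ?thesis using nz EP by simp
    next
      case False
      let ?R = "E_val (Q - {x}) (Restr s (Q - {x})) \<mu> z"
      have "z * ?D = (z + 1) * (E_val P r \<mu> z * ?R)"
        unfolding Restr_osum_right(1)[OF xQ] unfolding Restr_osum_right(2)[OF xQ]
        using rs ne False by (intro E_val_ordinal_sum0[OF \<mu>]) auto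
      with val[of z] have "z * (?E + \<i> * ?D) = (z + 1) * (E_val P r \<mu> z * (E_val Q s \<mu> z + \<i> * ?R))"
        by (simp add: algebra_simps)
      then show ?thesis using nz EP E_stableD(2)[OF stable(2) xQ z] by simp
    qed
  qed
  then show "?E + \<i> * ?D \<noteq> 0" by auto
qed

end

section \<open>Induction over the series-parallel construction\<close>

lemma poset_pair_union_labelling:
  assumes "labelled_poset P r \<omega>" "labelled_poset Q s \<nu>" "P \<inter> Q = {}"
    and "E_stable P r \<omega>" "E_stable Q s \<nu>" and \<mu>: "union_labelling P \<omega> Q \<nu> \<mu>"
  shows "poset_pair P r Q s \<mu>"
proof
  show "finite P" "finite Q" and rs: "r \<subseteq> P \<times> P" "s \<subseteq> Q \<times> Q" and "P \<inter> Q = {}"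
    using assms by (auto simp: labelled_poset_def order_on_defs)
  have "inj_on \<omega> P" "inj_on \<nu> Q" "inj_on \<mu> P" "inj_on \<mu> Q"
    using assms(1,2) \<mu> by (auto simp: labelled_poset_def union_labelling_def intro: inj_on_subset)
  then show "E_stable P r \<mu>" "E_stable Q s \<mu>"
    using E_stable_relabel[OF assms(4) rs(1)] E_stable_relabel[OF assms(5) rs(2)] \<mu>
    by (auto simp: union_labelling_def)
qed

lemma series_parallel_E_stable: "series_parallel S r \<mu> \<Longrightarrow> E_stable S r \<mu>"
proof (induction rule: series_parallel.induct)
  case (empty \<mu>)
  then show ?case by (simp add: E_stable_def unit_rooted_def E_poly_def)
next
  case (single a \<mu>)
  \<comment> \<open>The expression that must not vanish is thus \<open>z + \<i>\<close>.\<close>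
  have "E_poly ({a} - {a}) (Restr {(a, a)} ({a} - {a})) \<mu> = 1" by (simp add: E_poly_def)
  then show ?case
    by (auto simp: E_stable_def unit_rooted_def E_poly_singleton cpoly_pCons complex_eq_iff)
next
  case (osum0 P r \<omega> Q s \<nu> \<mu>)
  note lp = osum0.hyps(1,2)[THEN series_parallel_labelled_poset]
  have "poset_pair P r Q s \<mu>"
    using osum0 lp by (intro poset_pair_union_labelling) (auto simp: osum0_labelling_def)
  then interpret poset_pair P r Q s \<mu> .
  show ?case
  \<comment> \<open>With an empty summand the sum is just the other poset, and the factor
    \<open>(x + 1) / x\<close> would be wrong.\<close>
  proof (cases "P = {} \<or> Q = {}")
    case True
    then show ?thesis using stable rs by (auto simp: ordinal_sum_def)
  next
    case False
    then show ?thesis using osum0 lp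
      by (intro E_stable_ordinal_sum0) (auto simp: osum0_labelling_def labelled_poset_def order_on_defs)
  qed
next
  case (osum1 P r \<omega> Q s \<nu> \<mu>)
  note lp = osum1.hyps(1,2)[THEN series_parallel_labelled_poset]
  have "poset_pair P r Q s \<mu>"
    using osum1 lp by (intro poset_pair_union_labelling) (auto simp: osum1_labelling_def)
  then interpret poset_pair P r Q s \<mu> .
  show ?case using osum1 by (intro E_stable_ordinal_sum1) (auto simp: osum1_labelling_def)
next
  case (disjoint_union P r \<omega> Q s \<nu> \<mu>)
  note lp = disjoint_union.hyps(1,2)[THEN series_parallel_labelled_poset]
  have "poset_pair P r Q s \<mu>"
    using disjoint_union lp by (intro poset_pair_union_labelling) auto
  then interpret poset_pair P r Q s \<mu> .
  show ?case by (rule E_stable_disjoint_union)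
qed

lemma labelled_poset_Restr:
  assumes "labelled_poset P r \<omega>" "P' \<subseteq> P"
  shows "labelled_poset P' (Restr r P') \<omega>"
proof -
  have "finite P'" "inj_on \<omega> P'"
    using assms by (auto simp: labelled_poset_def intro: finite_subset inj_on_subset)
  moreover have "trans r" "antisym r" "refl_on P r" using assms by (auto simp: labelled_poset_def order_on_defs)
  then have "trans (Restr r P')" "antisym (Restr r P')" "refl_on P' (Restr r P')"
    using assms(2) by (auto simp: trans_Restr antisym_Restr refl_on_def)
  ultimately show ?thesis by (auto simp: labelled_poset_def order_on_defs)
qed

theorem corollary15:
  fixes S :: "'a set" and r :: "'a rel" and \<mu> :: "'a \<Rightarrow> nat" and x :: 'a
  assumes "series_parallel S r \<mu>" and "x \<in> S"
  shows "interlaces (E_poly (S - {x}) (Restr r (S - {x})) \<mu>) (E_poly S r \<mu>)"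
proof (rule hermite_biehler)
  have lp: "labelled_poset S r \<mu>" using assms(1) by (rule series_parallel_labelled_poset)
  then have "labelled_poset (S - {x}) (Restr r (S - {x})) \<mu>" by (rule labelled_poset_Restr) auto
  \<comment> \<open>Both degrees are cardinalities of the carriers.\<close>
  from degree_E_poly[OF this] degree_E_poly[OF lp]
  show "degree (E_poly S r \<mu>) = degree (E_poly (S - {x}) (Restr r (S - {x})) \<mu>) + 1"
    and "E_poly (S - {x}) (Restr r (S - {x})) \<mu> \<noteq> 0"
    using assms(2) lp card_Suc_Diff1[of S x] by (auto simp: labelled_poset_def)
  show "E_val S r \<mu> z + \<i> * E_val (S - {x}) (Restr r (S - {x})) \<mu> z \<noteq> 0" if "Im z > 0" for z
    using series_parallel_E_stable[OF assms(1)] assms(2) that by (rule E_stableD(2))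
qed

end
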